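(* Let $\Delta$ be a flag $(d-1)$-dimensional homology sphere (over $\mathbb{k}$). Then there is a map $\sigma:\Delta\to\Sigma_{d-1}$ which makes $\Delta$ a vertex-induced homology subdivision of $\Sigma_{d-1}$; moreover this subdivision is quasi-geometric and flag.
   Context: Fix a field $\mathbb{k}$. Simplicial complexes are finite abstract; $\mathrm{link}_\Delta(F)=\{G\setminus F: G\in\Delta, F\subseteq G\}$. A complex is flag if every minimal non-face has exactly two elements. $\Sigma_{d-1}$ denotes the simplicial complex on the ground set $\{u_1,\dots,u_d\}\cup\{v_1,\dots,v_d\}$ whose faces are the subsets containing at most one element of each $\{u_i,v_i\}$ (the boundary of the $d$-dimensional cross-polytope). A $(d-1)$-dimensional complex $\Delta$ is a homology sphere if for every $F\in\Delta$ (including $\varnothing$), $\widetilde H_i(\mathrm{link}_\Delta(F);\mathbb{k})$ is $\mathbb{k}$ for $i=\dim\mathrm{link}_\Delta(F)$ and $0$ otherwise. It is a homology ball if there is a subcomplex $\partial\Delta$ which is a $(d-2)$-dimensional homology sphere such that for every $F\in\Delta$ (including $\varnothing$), $\widetilde H_i(\mathrm{link}_\Delta(F);\mathbb{k})$ is $\mathbb{k}$ if $F\notin\partial\Delta$ and $i=\dim\mathrm{link}_\Delta(F)$, and $0$ otherwise; its interior is $\Delta\setminus\partial\Delta$. A homology subdivision of $\Delta$ is a complex $\Delta'$ with a map $\sigma:\Delta'\to\Delta$ such that for every $F\in\Delta$, $\Delta'_F:=\sigma^{-1}(2^F)$ is a subcomplex which is a homology ball of dimension $\dim F$ and $\sigma^{-1}(F)$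 is its set of interior faces. It is vertex-induced if for all $E\in\Delta'$, $F\in\Delta$: if every vertex of $E$ is a vertex of $\Delta'_F$ then $E\in\Delta'_F$. It is quasi-geometric if there are no $E\in\Delta'$ and $F\in\Delta$ with $\dim F<\dim E$ such that $\sigma(\{v\})\subseteq F$ for every vertex $v$ of $E$. It is flag if every $\Delta'_F$ is a flag complex. *)

theory Defs
  imports Complex_Main "HOL-Library.FuncSet"
begin

section \<open>Simplicial complexes\<close>

text \<open>
  The vertices of a complex \<open>\<Delta>\<close> are the elements of \<open>\<Union>\<Delta>\<close>, so the ground set contains no
  elements that are not vertices. The void complex \<open>{}\<close> is allowed; it is different from \<open>{{}}\<close>.
\<close>

definition simplicial_complex :: "'a set set \<Rightarrow> bool" where
  "simplicial_complex \<Delta> \<longleftrightarrow>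
     finite \<Delta> \<and> (\<forall>F\<in>\<Delta>. finite F) \<and> (\<forall>F\<in>\<Delta>. \<forall>G. G \<subseteq> F \<longrightarrow> G \<in> \<Delta>)"

definition face_dim :: "'a set \<Rightarrow> int" where
  "face_dim F = int (card F) - 1"

text \<open>
  The void complex gets dimension \<open>-2\<close>. It is then the \<open>-2\<close>-dimensional homology sphere, and
  \<open>{{}}\<close> is a \<open>-1\<close>-dimensional homology ball with void boundary. The definition of a homology
  subdivision needs this at the empty face.
\<close>

definition complex_dim :: "'a set set \<Rightarrow> int" where
  "complex_dim \<Delta> = (if \<Delta> = {} then -2 else Max (face_dim ` \<Delta>))"

definition link :: "'a set set \<Rightarrow> 'a set \<Rightarrow> 'a set set" where
  "link \<Delta> F = {G - F | G. G \<in> \<Delta> \<and> F \<subseteq> G}"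

definition flag_complex :: "'a set set \<Rightarrow> bool" where
  "flag_complex \<Delta> \<longleftrightarrow>
     (\<forall>N. N \<subseteq> \<Union>\<Delta> \<and> N \<notin> \<Delta> \<and> (\<forall>M. M \<subset> N \<longrightarrow> M \<in> \<Delta>) \<longrightarrow> card N = 2)"

section \<open>Reduced simplicial homology\<close>

text \<open>
  Faces are oriented by an arbitrary linear order, chosen once for each vertex type. Up to
  isomorphism, homology does not depend on this choice.
\<close>

definition vertex_order :: "'a rel" where
  "vertex_order = (SOME r. linear_order r)"

lemma linear_order_vertex_order: "linear_order (vertex_order :: 'a rel)"
proof -
  obtain r :: "'a rel" where "well_order r"
    using well_order_on by blast
  then have "linear_order r"
    by (simp add: well_order_on_def)
  then show ?thesis
    unfolding vertex_order_def by (rule someI)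
qed

text \<open>
  A chain maps each face to its coefficient. The empty face spans the chains of degree \<open>-1\<close>.
\<close>

definition chains :: "int \<Rightarrow> 'a set set \<Rightarrow> ('a set \<Rightarrow> 'k::field) set" where
  "chains i \<Delta> = {c. \<forall>F. c F \<noteq> 0 \<longrightarrow> F \<in> \<Delta> \<and> face_dim F = i}"

text \<open>
  If \<open>v\<close> is the vertex number \<open>j\<close> (counting from 0) of the face \<open>insert v G\<close>, then \<open>G\<close> occurs in
  the boundary of that face with coefficient \<open>(-1) ^ j\<close>.
\<close>

definition incidence_sign :: "'a \<Rightarrow> 'a set \<Rightarrow> 'k::field" where
  "incidence_sign v G = (-1) ^ card {w \<in> G. w \<noteq> v \<and> (w, v) \<in> vertex_order}"

definition boundary_map :: "'a set set \<Rightarrow> ('a set \<Rightarrow> 'k) \<Rightarrow> ('a set \<Rightarrow> 'k::field)" where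
  "boundary_map \<Delta> c = (\<lambda>G. \<Sum>v \<in> \<Union>\<Delta> - G. incidence_sign v G * c (insert v G))"

definition cycles :: "int \<Rightarrow> 'a set set \<Rightarrow> ('a set \<Rightarrow> 'k::field) set" where
  "cycles i \<Delta> = {z \<in> chains i \<Delta>. boundary_map \<Delta> z = (\<lambda>G. 0)}"

definition boundaries :: "int \<Rightarrow> 'a set set \<Rightarrow> ('a set \<Rightarrow> 'k::field) set" where
  "boundaries i \<Delta> = boundary_map \<Delta> ` chains (i + 1) \<Delta>"

definition homology_class ::
    "int \<Rightarrow> 'a set set \<Rightarrow> ('a set \<Rightarrow> 'k::field) \<Rightarrow> ('a set \<Rightarrow> 'k) set" where
  "homology_class i \<Delta> z = {(\<lambda>F. z F + b F) | b. b \<in> boundaries i \<Delta>}"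

definition reduced_homology :: "int \<Rightarrow> 'a set set \<Rightarrow> ('a set \<Rightarrow> 'k::field) set set" where
  "reduced_homology i \<Delta> = homology_class i \<Delta> ` cycles i \<Delta>"

definition homology_zero :: "'k::field itself \<Rightarrow> int \<Rightarrow> 'a set set \<Rightarrow> bool" where
  "homology_zero _ i \<Delta> \<longleftrightarrow>
     (reduced_homology i \<Delta> :: ('a set \<Rightarrow> 'k) set set) = {homology_class i \<Delta> (\<lambda>F. 0)}"

text \<open>
  Isomorphism of vector spaces with the field \<open>'k\<close>; the operations on homology are those induced
  from representatives.
\<close>

definition homology_iso_field :: "'k::field itself \<Rightarrow> int \<Rightarrow> 'a set set \<Rightarrow> bool" where
  "homology_iso_field _ i \<Delta> \<longleftrightarrow>
     (\<exists>\<phi> :: ('a set \<Rightarrow> 'k) set \<Rightarrow> 'k.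
        bij_betw \<phi> (reduced_homology i \<Delta>) UNIV \<and>
        (\<forall>y \<in> cycles i \<Delta>. \<forall>z \<in> cycles i \<Delta>.
           \<phi> (homology_class i \<Delta> (\<lambda>F. y F + z F))
             = \<phi> (homology_class i \<Delta> y) + \<phi> (homology_class i \<Delta> z)) \<and>
        (\<forall>a. \<forall>z \<in> cycles i \<Delta>.
           \<phi> (homology_class i \<Delta> (\<lambda>F. a * z F)) = a * \<phi> (homology_class i \<Delta> z)))"

section \<open>Homology spheres, balls and subdivisions\<close>

definition homology_sphere :: "'k::field itself \<Rightarrow> int \<Rightarrow> 'a set set \<Rightarrow> bool" where
  "homology_sphere K n \<Delta> \<longleftrightarrow>
     simplicial_complex \<Delta> \<and> complex_dim \<Delta> = n \<and>
     (\<forall>F\<in>\<Delta>. \<forall>i. if i = complex_dim (link \<Delta> F)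
                  then homology_iso_field K i (link \<Delta> F)
                  else homology_zero K i (link \<Delta> F))"

text \<open>
  The last condition determines the boundary \<open>B\<close>: a face of \<open>\<Delta>\<close> lies in \<open>B\<close> if and only if its
  link has no homology.
\<close>

definition homology_ball_with_boundary ::
    "'k::field itself \<Rightarrow> int \<Rightarrow> 'a set set \<Rightarrow> 'a set set \<Rightarrow> bool" where
  "homology_ball_with_boundary K n \<Delta> B \<longleftrightarrow>
     simplicial_complex \<Delta> \<and> complex_dim \<Delta> = n \<and>
     B \<subseteq> \<Delta> \<and> homology_sphere K (n - 1) B \<and>
     (\<forall>F\<in>\<Delta>. \<forall>i. if F \<notin> B \<and> i = complex_dim (link \<Delta> F)
                  then homology_iso_field K i (link \<Delta> F)
                  else homology_zero K i (link \<Delta> F))"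

definition restriction ::
    "'a set set \<Rightarrow> ('a set \<Rightarrow> 'b set) \<Rightarrow> 'b set \<Rightarrow> 'a set set" where
  "restriction \<Delta>' \<sigma> F = {E \<in> \<Delta>'. \<sigma> E \<subseteq> F}"

definition homology_subdivision ::
    "'k::field itself \<Rightarrow> 'a set set \<Rightarrow> ('a set \<Rightarrow> 'b set) \<Rightarrow> 'b set set \<Rightarrow> bool" where
  "homology_subdivision K \<Delta>' \<sigma> \<Delta> \<longleftrightarrow>
     simplicial_complex \<Delta>' \<and> simplicial_complex \<Delta> \<and> \<sigma> \<in> \<Delta>' \<rightarrow> \<Delta> \<and>
     (\<forall>F\<in>\<Delta>. \<exists>B. homology_ball_with_boundary K (face_dim F) (restriction \<Delta>' \<sigma> F) B \<and>
                 {E \<in> \<Delta>'. \<sigma> E = F} = restriction \<Delta>' \<sigma> F - B)"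

definition vertex_induced ::
    "'a set set \<Rightarrow> ('a set \<Rightarrow> 'b set) \<Rightarrow> 'b set set \<Rightarrow> bool" where
  "vertex_induced \<Delta>' \<sigma> \<Delta> \<longleftrightarrow>
     (\<forall>E\<in>\<Delta>'. \<forall>F\<in>\<Delta>. (\<forall>v\<in>E. {v} \<in> restriction \<Delta>' \<sigma> F) \<longrightarrow> E \<in> restriction \<Delta>' \<sigma> F)"

definition quasi_geometric ::
    "'a set set \<Rightarrow> ('a set \<Rightarrow> 'b set) \<Rightarrow> 'b set set \<Rightarrow> bool" where
  "quasi_geometric \<Delta>' \<sigma> \<Delta> \<longleftrightarrow>
     \<not> (\<exists>E\<in>\<Delta>'. \<exists>F\<in>\<Delta>. face_dim F < face_dim E \<and> (\<forall>v\<in>E. \<sigma> {v} \<subseteq> F))"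

definition flag_subdivision ::
    "'a set set \<Rightarrow> ('a set \<Rightarrow> 'b set) \<Rightarrow> 'b set set \<Rightarrow> bool" where
  "flag_subdivision \<Delta>' \<sigma> \<Delta> \<longleftrightarrow> (\<forall>F\<in>\<Delta>. flag_complex (restriction \<Delta>' \<sigma> F))"

section \<open>The boundary of the cross-polytope\<close>

datatype cross_vertex = Upper nat | Lower nat

text \<open>
  \<open>Upper i\<close> and \<open>Lower i\<close> are the antipodal vertices \<open>u\<^sub>i\<close> and \<open>v\<^sub>i\<close>. The argument is \<open>d\<close>, so the
  complex has dimension \<open>d - 1\<close>.
\<close>

definition cross_polytope_boundary :: "nat \<Rightarrow> cross_vertex set set" where
  "cross_polytope_boundary d =
     {F. F \<subseteq> Upper ` {1..d} \<union> Lower ` {1..d} \<and>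
         (\<forall>i\<in>{1..d}. card (F \<inter> {Upper i, Lower i}) \<le> 1)}"

end

theory Submission
  imports Defs "HOL-Library.Function_Algebras"
begin

text \<open>
  Choose a facet \<open>{x\<^sub>1, \<dots>, x\<^sub>d}\<close> of \<open>\<Delta>\<close> and let \<open>\<sigma>(E)\<close> consist of the \<open>u\<^sub>i\<close> with \<open>x\<^sub>i \<in> E\<close> and the \<open>v\<^sub>i\<close>
  with \<open>E \<union> {x\<^sub>i} \<notin> \<Delta>\<close>. Given a face \<open>F\<close> of the cross-polytope, let \<open>M\<close> be the link of the set of the
  \<open>x\<^sub>i\<close> with \<open>u\<^sub>i, v\<^sub>i \<notin> F\<close>, and let \<open>P\<close> and \<open>A\<close> be the sets of the \<open>x\<^sub>i\<close> with \<open>u\<^sub>i \<in> F\<close> and with \<open>v\<^sub>i \<in> F\<close>.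
  By flagness, the faces carried by \<open>F\<close> are the faces \<open>E\<close> of the flag sphere \<open>M\<close> with \<open>E \<union> P \<in> M\<close> and
  \<open>E \<inter> A = {}\<close>: the star of \<open>P\<close> truncated by \<open>A\<close>.

  Truncated stars are acyclic: they are cones if \<open>P \<noteq> {}\<close>, and otherwise they arise from a sphere by
  deleting the vertices of a face. So are their complements, the complexes of all \<open>E\<close> with
  \<open>P \<nsubseteq> E\<close> or \<open>E \<union> {a} \<in> M\<close> for some \<open>a \<in> A\<close>. By Mayer--Vietoris, the intersection of the two has the
  homology of a sphere of one dimension less. Since links of faces in the truncated star and in this
  intersection are complexes of the same kind inside links of \<open>M\<close>, the truncated star is a
  homology ball and the intersection is its boundary.
\<close>

section \<open>Complexes and links\<close>

lemma finite_vertices: "simplicial_complex X \<Longrightarrow> finite (\<Union>X)"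
  by (auto simp: simplicial_complex_def)

lemma simplicial_complexD:
  "simplicial_complex X \<Longrightarrow> F \<in> X \<Longrightarrow> G \<subseteq> F \<Longrightarrow> G \<in> X"
  by (auto simp: simplicial_complex_def)

lemma finite_face: "simplicial_complex X \<Longrightarrow> F \<in> X \<Longrightarrow> finite F"
  by (auto simp: simplicial_complex_def)

lemma simplicial_complex_subset:
  assumes "simplicial_complex X" "Y \<subseteq> X" "\<And>F G. F \<in> Y \<Longrightarrow> G \<subseteq> F \<Longrightarrow> G \<in> Y"
  shows "simplicial_complex Y"
  using assms unfolding simplicial_complex_def by (meson finite_subset subsetD)

lemma simplicial_complex_Un:
  "simplicial_complex X \<Longrightarrow> simplicial_complex Y \<Longrightarrow> simplicial_complex (X \<union> Y)"
  by (auto simp: simplicial_complex_def)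

lemma simplicial_complex_Int:
  "simplicial_complex X \<Longrightarrow> simplicial_complex Y \<Longrightarrow> simplicial_complex (X \<inter> Y)"
  by (auto simp: simplicial_complex_def)

lemma in_link_iff:
  "simplicial_complex X \<Longrightarrow> G \<in> link X F \<longleftrightarrow> F \<inter> G = {} \<and> F \<union> G \<in> X"
  unfolding link_def by (auto simp: Un_absorb1 intro!: exI[of _ "F \<union> G"])

lemma link_subset: "simplicial_complex X \<Longrightarrow> link X F \<subseteq> X"
  by (auto simp: in_link_iff intro: simplicial_complexD)

lemma simplicial_complex_link: "simplicial_complex X \<Longrightarrow> simplicial_complex (link X F)"
  by (rule simplicial_complex_subset[of X]) (auto simp: in_link_iff intro: simplicial_complexD)

lemma link_empty [simp]: "link X {} = X"
  by (simp add: link_def)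

lemma link_link:
  assumes "simplicial_complex X" "F \<inter> G = {}"
  shows "link (link X F) G = link X (F \<union> G)"
  using assms by (auto simp: in_link_iff simplicial_complex_link Un_assoc)

section \<open>Dimension of complexes and of vertex links\<close>

lemma complex_dim_eq_iff:
  assumes "simplicial_complex X" "X \<noteq> {}"
  shows "complex_dim X = m \<longleftrightarrow> (\<exists>F\<in>X. face_dim F = m) \<and> (\<forall>F\<in>X. face_dim F \<le> m)"
proof -
  have "finite (face_dim ` X)" "face_dim ` X \<noteq> {}"
    using assms by (auto simp: simplicial_complex_def)
  then have "Max (face_dim ` X) = m \<longleftrightarrow> m \<in> face_dim ` X \<and> (\<forall>k\<in>face_dim ` X. k \<le> m)"
    by (rule Max_eq_iff)
  then show ?thesis
    using assms by (auto simp: complex_dim_def)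
qed

lemma face_dim_le:
  "simplicial_complex X \<Longrightarrow> F \<in> X \<Longrightarrow> face_dim F \<le> complex_dim X"
  using complex_dim_eq_iff by blast

lemma face_dim_link_vertex:
  assumes X: "simplicial_complex X" and E: "E \<in> link X {v}"
  shows "face_dim E \<le> complex_dim X - 1"
proof -
  have "v \<notin> E" "insert v E \<in> X"
    using E by (auto simp: in_link_iff[OF X])
  moreover have "finite E"
    using finite_face[OF simplicial_complex_link[OF X] E] .
  ultimately show ?thesis
    using face_dim_le[OF X, of "insert v E"] by (simp add: face_dim_def)
qed

text \<open>Flag complexes are clique complexes: a clique whose proper subsets are all faces could
  only be a minimal non-face if it were a pair, and its pairs are faces. The instances
  \<open>v = w\<close> make every element of \<open>N\<close> a vertex, and \<open>N = {}\<close>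
  rules out the void complex on both sides.\<close>

lemma flag_complex_iff:
  assumes X: "simplicial_complex X"
  shows "flag_complex X \<longleftrightarrow> (\<forall>N. finite N \<and> (\<forall>v\<in>N. \<forall>w\<in>N. {v, w} \<in> X) \<longrightarrow> N \<in> X)"
    (is "_ \<longleftrightarrow> ?R")
proof
  assume flag: "flag_complex X"
  have "N \<in> X" if "finite N" "\<forall>v\<in>N. \<forall>w\<in>N. {v, w} \<in> X" for N
    using that
  proof (induction N rule: finite_psubset_induct)
    case (psubset N)
    have "M \<in> X" if "M \<subset> N" for M
      using psubset that by (meson psubset_imp_subset subsetD)
    moreover have "N \<subseteq> \<Union>X"
      using psubset.prems by blast
    ultimately have "N \<in> X \<or> card N = 2"
      using flag unfolding flag_complex_def by blast
    then show ?case
      using psubset.prems by (auto simp: card_2_iff)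
  qed
  then show ?R by blast
next
  assume R: ?R
  show "flag_complex X"
    unfolding flag_complex_def
  proof (intro allI impI)
    fix N assume N: "N \<subseteq> \<Union>X \<and> N \<notin> X \<and> (\<forall>M. M \<subset> N \<longrightarrow> M \<in> X)"
    have fin: "finite N"
      using N finite_subset[OF _ finite_vertices[OF X]] by blast
    have "\<not> (\<forall>v\<in>N. \<forall>w\<in>N. {v, w} \<in> X)"
      using R N fin by metis
    then obtain v w where vw: "v \<in> N" "w \<in> N" "{v, w} \<notin> X"
      by blast
    then have "{v, w} = N"
      using N by (metis empty_subsetI insert_subset psubsetI)
    moreover have "v \<noteq> w"
    proof
      assume "v = w"
      obtain F where "F \<in> X" "v \<in> F"
        using N vw(1) by blast
      then have "{v} \<in> X"
        by (auto intro: simplicial_complexD[OF X])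
      with \<open>v = w\<close> vw show False by simp
    qed
    ultimately show "card N = 2"
      by auto
  qed
qed

lemma flag_complexD:
  assumes "simplicial_complex X" "flag_complex X" "finite N"
    and "\<And>v w. v \<in> N \<Longrightarrow> w \<in> N \<Longrightarrow> {v, w} \<in> X"
  shows "N \<in> X"
proof -
  have "\<forall>v\<in>N. \<forall>w\<in>N. {v, w} \<in> X"
    using assms(4) by (intro ballI)
  with assms(3) show ?thesis
    using iffD1[OF flag_complex_iff[OF assms(1)] assms(2)] by (elim allE[of _ N] impE) (rule conjI)
qed

text \<open>The form in which flagness is mostly used below. Any two vertices of
  \<open>E \<union> S\<close> lie together in \<open>E\<close>, in \<open>S\<close>, or in some
  \<open>insert a E\<close>, so the union is a clique.\<close>

lemma flag_complex_Un:
  assumes "simplicial_complex X" "flag_complex X" "E \<in> X" "S \<in> X" "\<And>a. a \<in> S \<Longrightarrow> insert a E \<in> X"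
  shows "E \<union> S \<in> X"
proof -
  have "{v, w} \<in> X" if "v \<in> E \<union> S" "w \<in> E \<union> S" for v w
  proof -
    have "{v, w} \<subseteq> E \<or> {v, w} \<subseteq> S \<or> {v, w} \<subseteq> insert w E \<and> w \<in> S \<or> {v, w} \<subseteq> insert v E \<and> v \<in> S"
      using that by auto
    then show ?thesis
      using assms(3-5) simplicial_complexD[OF assms(1)] by metis
  qed
  then show ?thesis
    using assms(3,4) by (intro flag_complexD[OF assms(1,2), of "E \<union> S"]) (auto dest: finite_face[OF assms(1)])
qed

lemma flag_complex_link:
  assumes X: "simplicial_complex X" and flag: "flag_complex X" and F: "F \<in> X"
  shows "flag_complex (link X F)"
proof (intro iffD2[OF flag_complex_iff[OF simplicial_complex_link[OF X]]] allI impI)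
  fix N
  assume N: "finite N \<and> (\<forall>v\<in>N. \<forall>w\<in>N. {v, w} \<in> link X F)"
  note fin = conjunct1[OF N] and pairs = conjunct2[OF N]
  have "N \<in> X"
    by (rule flag_complexD[OF X flag fin]) (meson pairs link_subset[OF X] subsetD)
  moreover have single: "insert v F \<in> X \<and> v \<notin> F" if "v \<in> N" for v
    using that pairs by (force simp: in_link_iff[OF X])
  ultimately have "F \<union> N \<in> X"
    by (intro flag_complex_Un[OF X flag F]) auto
  then show "N \<in> link X F"
    using single by (auto simp: in_link_iff[OF X])
qed

section \<open>Chains and boundaries\<close>

lemma chains_0 [simp]: "0 \<in> chains i X"
  by (simp add: chains_def)

lemma chains_add: "x \<in> chains i X \<Longrightarrow> y \<in> chains i X \<Longrightarrow> x + y \<in> chains i X"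
  unfolding chains_def by force

lemma chains_diff: "x \<in> chains i X \<Longrightarrow> y \<in> chains i X \<Longrightarrow> x - y \<in> chains i X"
  unfolding chains_def by force

lemma chains_scale: "x \<in> chains i X \<Longrightarrow> (\<lambda>F. a * x F) \<in> chains i X"
  unfolding chains_def by force

lemma chains_mono: "X \<subseteq> Y \<Longrightarrow> x \<in> chains i X \<Longrightarrow> x \<in> chains i Y"
  unfolding chains_def by force

lemma chains_Int: "x \<in> chains i X \<Longrightarrow> x \<in> chains i Y \<Longrightarrow> x \<in> chains i (X \<inter> Y)"
  unfolding chains_def by force

lemma chains_Un:
  assumes "c \<in> chains i (X \<union> Y)"
  obtains x y where "x \<in> chains i X" "y \<in> chains i Y" "c = x + y"
proof
  show "(\<lambda>F. if F \<in> X then c F else 0) \<in> chains i X"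
    "(\<lambda>F. if F \<in> X then 0 else c F) \<in> chains i Y"
    using assms by (auto simp: chains_def split: if_splits)
qed (simp add: fun_eq_iff)

lemma chains_above_dim:
  assumes "simplicial_complex X" "complex_dim X < i" "c \<in> chains i X"
  shows "c = 0"
  using assms face_dim_le[OF assms(1)] by (fastforce simp: chains_def)

lemma boundary_map_add: "boundary_map X (x + y) = boundary_map X x + boundary_map X y"
  by (simp add: boundary_map_def fun_eq_iff distrib_left sum.distrib)

lemma boundary_map_diff: "boundary_map X (x - y) = boundary_map X x - boundary_map X y"
  by (simp add: boundary_map_def fun_eq_iff right_diff_distrib sum_subtractf)

lemma boundary_map_scale: "boundary_map X (\<lambda>F. a * x F) = (\<lambda>F. a * boundary_map X x F)"
  by (simp add: boundary_map_def fun_eq_iff sum_distrib_left mult_ac)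

lemma boundary_map_0 [simp]: "boundary_map X 0 = 0"
  by (simp add: boundary_map_def fun_eq_iff)

text \<open>The complex enters \<open>boundary_map\<close> only through the vertices over which the
  sum runs, and vertices outside \<open>X\<close> contribute zero for a chain of
  \<open>X\<close>.\<close>

lemma boundary_map_subcomplex:
  assumes "simplicial_complex Y" "X \<subseteq> Y" "c \<in> chains i X"
  shows "boundary_map X c = boundary_map Y c"
proof
  fix G
  show "boundary_map X c G = boundary_map Y c G"
    unfolding boundary_map_def
    using assms finite_vertices[OF assms(1)]
    by (intro sum.mono_neutral_left) (auto simp: chains_def)
qed

lemma boundary_map_chains:
  assumes X: "simplicial_complex X" and c: "c \<in> chains i X"
  shows "boundary_map X c \<in> chains (i - 1) X"
proof -
  have "G \<in> X \<and> face_dim G = i - 1" if nz: "boundary_map X c G \<noteq> 0" for G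
  proof -
    obtain v where v: "v \<notin> G" "c (insert v G) \<noteq> 0"
      using nz unfolding boundary_map_def by (metis (mono_tags, lifting) DiffE mult_zero_right sum.neutral)
    then have "insert v G \<in> X" "face_dim (insert v G) = i"
      using c by (auto simp: chains_def)
    moreover from this have "finite G"
      using finite_face[OF X, of "insert v G"] by simp
    ultimately show ?thesis
      using v(1) simplicial_complexD[OF X, of "insert v G" G] by (auto simp: face_dim_def)
  qed
  then show ?thesis
    by (simp add: chains_def)
qed

section \<open>Orientation signs and the square of the boundary map\<close>

lemma incidence_sign_square [simp]:
  "incidence_sign v G * (incidence_sign v G :: 'k::field) = 1"
  by (simp add: incidence_sign_def flip: power_mult_distrib)

lemma incidence_sign_square' [simp]:
  "incidence_sign v G * (incidence_sign v G * (c :: 'k::field)) = c"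
  by (simp flip: mult.assoc)

lemma incidence_sign_neq_0 [simp]: "incidence_sign v G \<noteq> (0 :: 'k::field)"
  by (simp add: incidence_sign_def)

text \<open>Inserting \<open>a\<close> into \<open>G\<close> changes the sign at \<open>b\<close>
  exactly when \<open>a\<close> precedes \<open>b\<close>. Of two distinct vertices exactly one
  precedes the other, so exactly one of the two products changes sign.\<close>

lemma incidence_sign_swap:
  assumes "v \<noteq> w" "v \<notin> G" "w \<notin> G" "finite G"
  shows "incidence_sign v G * incidence_sign w (insert v G)
    = - (incidence_sign w G * incidence_sign v (insert w G) :: 'k::field)"
proof -
  have insert: "incidence_sign b (insert a G)
      = incidence_sign b G * (if (a, b) \<in> vertex_order then -1 else (1 :: 'k))"
    if "a \<noteq> b" "a \<notin> G" for a b
  proof -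
    have "{u \<in> insert a G. u \<noteq> b \<and> (u, b) \<in> vertex_order}
      = (if (a, b) \<in> vertex_order then insert a {u \<in> G. u \<noteq> b \<and> (u, b) \<in> vertex_order}
         else {u \<in> G. u \<noteq> b \<and> (u, b) \<in> vertex_order})"
      using that by auto
    then show ?thesis
      using that assms(4) by (simp add: incidence_sign_def)
  qed
  have "(v, w) \<in> vertex_order \<longleftrightarrow> (w, v) \<notin> vertex_order"
    using linear_order_vertex_order assms(1)
    by (metis UNIV_I antisymD linear_order_on_def partial_order_on_def total_on_def)
  then show ?thesis
    using assms insert[of v w] insert[of w v] by auto
qed

text \<open>The double sum runs over ordered pairs of distinct vertices outside \<open>G\<close>.
  Swapping a pair keeps the face and reverses the sign, so the increasing pairs cancel the
  decreasing ones.\<close>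

lemma boundary_map_boundary_map:
  assumes X: "simplicial_complex X" and c: "c \<in> chains i X"
  shows "boundary_map X (boundary_map X c) = (0 :: 'a set \<Rightarrow> 'k::field)"
proof
  fix G :: "'a set"
  show "boundary_map X (boundary_map X c) G = (0 :: 'a set \<Rightarrow> 'k) G"
  proof (cases "finite G")
    case False
    then have "G \<notin> X"
      using finite_face[OF X] by blast
    then show ?thesis
      using boundary_map_chains[OF X boundary_map_chains[OF X c]] by (auto simp: chains_def)
  next
    case True
    let ?W = "\<Union>X - G"
    let ?f = "\<lambda>(v, w). incidence_sign v G * incidence_sign w (insert v G) * c (insert w (insert v G))"
    let ?T = "{(v, w). v \<in> ?W \<and> w \<in> ?W \<and> v \<noteq> w \<and> (v, w) \<in> vertex_order}"
    let ?T' = "{(v, w). v \<in> ?W \<and> w \<in> ?W \<and> v \<noteq> w \<and> (w, v) \<in> vertex_order}"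
    have W: "finite ?W"
      using finite_vertices[OF X] by simp
    then have fin: "finite ?T" "finite ?T'"
      by (auto intro: finite_subset[of _ "?W \<times> ?W"])
    have order: "v = w \<or> ((v, w) \<in> vertex_order \<longleftrightarrow> (w, v) \<notin> vertex_order)" for v w :: 'a
      using linear_order_vertex_order
      by (metis UNIV_I antisymD linear_order_on_def partial_order_on_def total_on_def)
    have "boundary_map X (boundary_map X c) G
      = (\<Sum>v\<in>?W. \<Sum>w\<in>\<Union>X - insert v G. ?f (v, w))"
      by (simp add: boundary_map_def sum_distrib_left mult.assoc)
    also have "\<dots> = sum ?f (SIGMA v:?W. \<Union>X - insert v G)"
      using W finite_vertices[OF X] by (subst sum.Sigma) auto
    also have "(SIGMA v:?W. \<Union>X - insert v G) = ?T \<union> ?T'"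
      using order by auto
    also have "sum ?f \<dots> = sum ?f ?T + sum ?f ?T'"
      using fin order by (intro sum.union_disjoint) auto
    also have "sum ?f ?T' = sum (\<lambda>p. - ?f p) ?T"
    proof (rule sum.reindex_bij_witness[where i = prod.swap and j = prod.swap])
      fix p assume "p \<in> ?T'"
      then show "- ?f (prod.swap p) = ?f p"
        using incidence_sign_swap[of "fst p" "snd p" G, where 'k = 'k] True
        by (auto simp: insert_commute)
    qed auto
    finally show ?thesis
      by (simp add: sum_negf)
  qed
qed

section \<open>Vanishing and one-dimensional homology\<close>

lemma cycles_iff: "z \<in> cycles i X \<longleftrightarrow> z \<in> chains i X \<and> boundary_map X z = 0"
  by (simp add: cycles_def zero_fun_def)

lemma boundariesE:
  assumes "b \<in> boundaries i X"
  obtains c where "c \<in> chains (i + 1) X" "b = boundary_map X c"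
  using assms by (auto simp: boundaries_def)

lemma boundaries_0 [simp]: "0 \<in> boundaries i X"
  unfolding boundaries_def by (rule image_eqI[where x = 0]) auto

lemma boundaries_add: "x \<in> boundaries i X \<Longrightarrow> y \<in> boundaries i X \<Longrightarrow> x + y \<in> boundaries i X"
  by (auto simp: boundaries_def chains_add simp flip: boundary_map_add)

lemma boundaries_diff: "x \<in> boundaries i X \<Longrightarrow> y \<in> boundaries i X \<Longrightarrow> x - y \<in> boundaries i X"
  by (auto simp: boundaries_def chains_diff simp flip: boundary_map_diff)

lemma boundaries_scale: "x \<in> boundaries i X \<Longrightarrow> (\<lambda>F. a * x F) \<in> boundaries i X"
  by (auto simp: boundaries_def chains_scale simp flip: boundary_map_scale)

lemma cycles_0 [simp]: "0 \<in> cycles i X"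
  by (simp add: cycles_iff)

lemma cycles_scale: "x \<in> cycles i X \<Longrightarrow> (\<lambda>F. a * x F) \<in> cycles i X"
  by (auto simp: cycles_iff boundary_map_scale chains_scale zero_fun_def)

lemma homology_class_eq_iff:
  fixes y z :: "'a set \<Rightarrow> 'k::field"
  shows "homology_class i X y = homology_class i X z \<longleftrightarrow> y - z \<in> boundaries i X"
proof
  have expand: "homology_class i X z = {z + b | b. b \<in> boundaries i X}" for z :: "'a set \<Rightarrow> 'k"
    by (simp add: homology_class_def plus_fun_def)
  {
    assume "homology_class i X y = homology_class i X z"
    moreover have "y \<in> homology_class i X y"
      unfolding expand using boundaries_0[of i X] by (auto intro!: exI[of _ 0])
    ultimately show "y - z \<in> boundaries i X"
      unfolding expand by auto
  next
    assume *: "y - z \<in> boundaries i X"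
    have "y + b = z + (y - z + b)" "z + b = y + (b - (y - z))" for b
      by simp_all
    with * show "homology_class i X y = homology_class i X z"
      unfolding expand using boundaries_add[OF *] boundaries_diff[OF _ *] by blast
  }
qed

lemma homology_zero_iff:
  "homology_zero TYPE('k::field) i X \<longleftrightarrow> (cycles i X :: ('a set \<Rightarrow> 'k) set) \<subseteq> boundaries i X"
proof -
  have "homology_zero TYPE('k) i X
    \<longleftrightarrow> (\<forall>z \<in> cycles i X. homology_class i X z = homology_class i X (0 :: 'a set \<Rightarrow> 'k))"
    unfolding homology_zero_def reduced_homology_def zero_fun_def[symmetric]
    using cycles_0[of i X, where 'b = 'k] by blast
  then show ?thesis
    by (auto simp: homology_class_eq_iff)
qed

text \<open>A generator replaces the abstract isomorphism: \<open>Z\<close> is a cycle whose class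
  is sent to 1. Conversely, since \<open>Z\<close> is not a boundary, the coefficient of a cycle
  with respect to \<open>Z\<close> is unique, and it defines the isomorphism.\<close>

lemma homology_iso_field_iff:
  "homology_iso_field TYPE('k::field) i X \<longleftrightarrow>
     (\<exists>Z :: 'a set \<Rightarrow> 'k. Z \<in> cycles i X \<and> Z \<notin> boundaries i X \<and>
       (\<forall>z \<in> cycles i X. \<exists>a. z - (\<lambda>F. a * Z F) \<in> boundaries i X))"
proof
  assume "homology_iso_field TYPE('k) i X"
  then obtain \<phi> :: "('a set \<Rightarrow> 'k) set \<Rightarrow> 'k"
    where bij: "bij_betw \<phi> (reduced_homology i X) UNIV"
      and scale: "\<And>a z. z \<in> cycles i X \<Longrightarrow>
        \<phi> (homology_class i X (\<lambda>F. a * z F)) = a * \<phi> (homology_class i X z)"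
    unfolding homology_iso_field_def by blast
  have inj: "y - z \<in> boundaries i X"
    if "y \<in> cycles i X" "z \<in> cycles i X" "\<phi> (homology_class i X y) = \<phi> (homology_class i X z)" for y z
    using that bij unfolding bij_betw_def inj_on_def reduced_homology_def
    by (auto simp flip: homology_class_eq_iff)
  have "1 \<in> \<phi> ` reduced_homology i X"
    using bij by (simp add: bij_betw_def)
  then obtain Z where Z: "Z \<in> cycles i X" "\<phi> (homology_class i X Z) = 1"
    unfolding reduced_homology_def by auto
  have "Z \<notin> boundaries i X"
  proof
    assume "Z \<in> boundaries i X"
    then have "homology_class i X Z = homology_class i X (\<lambda>F. 0 * Z F)"
      by (simp add: homology_class_eq_iff flip: zero_fun_def)
    then show False
      using scale[OF Z(1), of 0] Z(2) by simp
  qed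
  moreover have "z - (\<lambda>F. \<phi> (homology_class i X z) * Z F) \<in> boundaries i X" if "z \<in> cycles i X" for z
    using that Z scale by (intro inj cycles_scale) auto
  ultimately show "\<exists>Z :: 'a set \<Rightarrow> 'k. Z \<in> cycles i X \<and> Z \<notin> boundaries i X \<and>
       (\<forall>z \<in> cycles i X. \<exists>a. z - (\<lambda>F. a * Z F) \<in> boundaries i X)"
    using Z(1) by blast
next
  assume "\<exists>Z :: 'a set \<Rightarrow> 'k. Z \<in> cycles i X \<and> Z \<notin> boundaries i X \<and>
       (\<forall>z \<in> cycles i X. \<exists>a. z - (\<lambda>F. a * Z F) \<in> boundaries i X)"
  then obtain Z :: "'a set \<Rightarrow> 'k" and q
    where Z: "Z \<in> cycles i X" "Z \<notin> boundaries i X"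
      and q: "\<And>z. z \<in> cycles i X \<Longrightarrow> z - (\<lambda>F. q z * Z F) \<in> boundaries i X"
    by metis
  have uniq: "a = b" if "z - (\<lambda>F. a * Z F) \<in> boundaries i X" "z - (\<lambda>F. b * Z F) \<in> boundaries i X" for z a b
  proof (rule ccontr)
    assume "a \<noteq> b"
    have "(\<lambda>F. inverse (b - a) * ((z - (\<lambda>F. a * Z F)) - (z - (\<lambda>F. b * Z F))) F) \<in> boundaries i X"
      using boundaries_scale[OF boundaries_diff[OF that]] .
    also have "(\<lambda>F. inverse (b - a) * ((z - (\<lambda>F. a * Z F)) - (z - (\<lambda>F. b * Z F))) F) = Z"
      using \<open>a \<noteq> b\<close> by (auto simp: fun_eq_iff field_simps)
    finally show False
      using Z(2) by simp
  qed
  \<comment> \<open>\<open>\<phi>\<close> reads off the coefficient of an arbitrarily chosen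
    representative; \<open>uniq\<close> makes the result independent of the choice.\<close>
  define \<phi> where "\<phi> C = q (SOME z. z \<in> cycles i X \<and> homology_class i X z = C)" for C
  have \<phi>: "\<phi> (homology_class i X z) = a"
    if z: "z \<in> cycles i X" and a: "z - (\<lambda>F. a * Z F) \<in> boundaries i X" for z a
  proof -
    define y where "y = (SOME y. y \<in> cycles i X \<and> homology_class i X y = homology_class i X z)"
    have y: "y \<in> cycles i X" "homology_class i X y = homology_class i X z"
      unfolding y_def using someI[of "\<lambda>y. y \<in> cycles i X \<and> homology_class i X y = homology_class i X z"] z
      by auto
    have "y - z + (z - (\<lambda>F. a * Z F)) \<in> boundaries i X"
      using y(2) a by (intro boundaries_add) (simp_all add: homology_class_eq_iff)
    then have "q y = a"
      using uniq q[OF y(1)] by simp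
    then show ?thesis
      by (simp add: \<phi>_def y_def)
  qed
  have \<phi>q: "\<phi> (homology_class i X z) = q z" if "z \<in> cycles i X" for z
    using \<phi> q that by blast
  have "inj_on \<phi> (reduced_homology i X)"
  proof (rule inj_onI)
    fix C D assume "C \<in> reduced_homology i X" "D \<in> reduced_homology i X" and eq: "\<phi> C = \<phi> D"
    then obtain y z where yz: "y \<in> cycles i X" "z \<in> cycles i X"
      and CD: "C = homology_class i X y" "D = homology_class i X z"
      by (auto simp: reduced_homology_def)
    have "q y = q z"
      using eq yz by (simp add: CD \<phi>q)
    then have "y - z \<in> boundaries i X"
      using boundaries_diff[OF q[OF yz(1)] q[OF yz(2)]] by simp
    then show "C = D"
      by (simp add: CD homology_class_eq_iff)
  qed
  moreover have "a \<in> \<phi> ` reduced_homology i X" for a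
  proof -
    have "\<phi> (homology_class i X (\<lambda>F. a * Z F)) = a"
      using \<phi>[OF cycles_scale[OF Z(1)], of a] by simp
    then show ?thesis
      using cycles_scale[OF Z(1)] unfolding reduced_homology_def by (metis imageI)
  qed
  moreover have "\<phi> (homology_class i X (\<lambda>F. y F + z F))
      = \<phi> (homology_class i X y) + \<phi> (homology_class i X z)"
    if yz: "y \<in> cycles i X" "z \<in> cycles i X" for y z
  proof -
    have split: "y + z - (\<lambda>F. (q y + q z) * Z F) = y - (\<lambda>F. q y * Z F) + (z - (\<lambda>F. q z * Z F))"
      by (simp add: fun_eq_iff algebra_simps)
    have "y + z - (\<lambda>F. (q y + q z) * Z F) \<in> boundaries i X"
      unfolding split by (rule boundaries_add[OF q[OF yz(1)] q[OF yz(2)]])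
    then have "\<phi> (homology_class i X (y + z)) = q y + q z"
      using yz by (intro \<phi>) (auto simp: cycles_iff chains_add boundary_map_add)
    then show ?thesis
      using yz by (simp add: \<phi>q plus_fun_def)
  qed
  moreover have "\<phi> (homology_class i X (\<lambda>F. a * z F)) = a * \<phi> (homology_class i X z)"
    if z: "z \<in> cycles i X" for a z
  proof -
    have split: "(\<lambda>F. a * z F) - (\<lambda>F. (a * q z) * Z F) = (\<lambda>F. a * (z - (\<lambda>F. q z * Z F)) F)"
      by (simp add: fun_eq_iff algebra_simps)
    have "(\<lambda>F. a * z F) - (\<lambda>F. (a * q z) * Z F) \<in> boundaries i X"
      unfolding split by (rule boundaries_scale[OF q[OF z]])
    then show ?thesis
      using \<phi>[OF cycles_scale[OF z], of a "a * q z"] z by (simp only: \<phi>q)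
  qed
  ultimately show "homology_iso_field TYPE('k) i X"
    unfolding homology_iso_field_def bij_betw_def by (intro exI[of _ \<phi>]) auto
qed

section \<open>Homology of subcomplexes computed inside an ambient complex\<close>

lemma boundary_map_chains_subcomplex:
  assumes "simplicial_complex Y" "simplicial_complex X" "X \<subseteq> Y" "c \<in> chains i X"
  shows "boundary_map Y c \<in> chains (i - 1) X"
  using boundary_map_chains[OF assms(2,4)] boundary_map_subcomplex[OF assms(1,3,4)] by simp

lemma boundary_map_chains_subcomplex':
  assumes "simplicial_complex Y" "simplicial_complex X" "X \<subseteq> Y" "c \<in> chains (i + 1) X"
  shows "boundary_map Y c \<in> chains i X"
  using boundary_map_chains_subcomplex[OF assms] by simp

lemma cycles_subcomplex:
  assumes "simplicial_complex Y" "X \<subseteq> Y"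
  shows "z \<in> cycles i X \<longleftrightarrow> z \<in> chains i X \<and> boundary_map Y z = 0"
  unfolding cycles_iff using boundary_map_subcomplex[OF assms] by metis

lemma boundaries_subcomplex:
  assumes "simplicial_complex Y" "X \<subseteq> Y"
  shows "boundaries i X = boundary_map Y ` chains (i + 1) X"
  using boundary_map_subcomplex[OF assms] unfolding boundaries_def by (intro image_cong) auto

text \<open>The boundary operator is that of an ambient complex \<open>Y\<close>, so that several
  subcomplexes can share one operator in the Mayer--Vietoris arguments.\<close>

lemma homology_zeroD:
  fixes z :: "'a set \<Rightarrow> 'k::field"
  assumes "homology_zero TYPE('k) i X" "simplicial_complex Y" "X \<subseteq> Y"
    and "z \<in> chains i X" "boundary_map Y z = 0"
  shows "\<exists>c\<in>chains (i + 1) X. z = boundary_map Y c"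
proof -
  have "z \<in> cycles i X"
    using assms by (simp add: cycles_subcomplex)
  then have "z \<in> boundaries i X"
    using assms(1) by (auto simp: homology_zero_iff)
  then show ?thesis
    by (auto simp: boundaries_subcomplex[OF assms(2,3)])
qed

lemma homology_zeroI:
  assumes "simplicial_complex Y" "X \<subseteq> Y"
    and "\<And>z :: 'a set \<Rightarrow> 'k::field. z \<in> chains i X \<Longrightarrow> boundary_map Y z = 0
      \<Longrightarrow> \<exists>c\<in>chains (i + 1) X. z = boundary_map Y c"
  shows "homology_zero TYPE('k) i X"
  unfolding homology_zero_iff
proof
  fix z :: "'a set \<Rightarrow> 'k"
  assume "z \<in> cycles i X"
  then have "\<exists>c\<in>chains (i + 1) X. z = boundary_map Y c"
    by (intro assms(3)) (simp_all add: cycles_subcomplex[OF assms(1,2)])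
  then show "z \<in> boundaries i X"
    unfolding boundaries_subcomplex[OF assms(1,2)] by blast
qed

lemma homology_zero_void: "homology_zero TYPE('k::field) i {}"
proof -
  have "z = 0" if "z \<in> cycles i {}" for z :: "'a set \<Rightarrow> 'k"
    using that by (auto simp: cycles_iff chains_def fun_eq_iff)
  then show ?thesis
    unfolding homology_zero_iff using boundaries_0 by blast
qed

text \<open>The chain \<open>c\<close> below is the join of \<open>a\<close> with the cycle \<open>z\<close>.\<close>

lemma homology_zero_cone:
  assumes X: "simplicial_complex X" and cone: "\<And>E. E \<in> X \<Longrightarrow> insert a E \<in> X"
  shows "homology_zero TYPE('k::field) i X"
proof (rule homology_zeroI[OF X subset_refl])
  fix z :: "'a set \<Rightarrow> 'k"
  assume z: "z \<in> chains i X" and cyc: "boundary_map X z = 0"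
  define c :: "'a set \<Rightarrow> 'k" where
    "c = (\<lambda>F. if a \<in> F then incidence_sign a (F - {a}) * z (F - {a}) else 0)"
  let ?V = "\<Union>X"
  have V: "finite ?V"
    using finite_vertices[OF X] .
  have fin: "finite G" if "z G \<noteq> 0" for G
    using that z finite_face[OF X] by (auto simp: chains_def)
  have "c \<in> chains (i + 1) X"
    unfolding chains_def
  proof (intro CollectI allI impI)
    fix F assume "c F \<noteq> 0"
    then have "a \<in> F" "z (F - {a}) \<noteq> 0"
      by (auto simp: c_def split: if_splits)
    moreover from this have "F - {a} \<in> X" "face_dim (F - {a}) = i" "finite (F - {a})"
      using z fin[of "F - {a}"] by (auto simp: chains_def)
    moreover have "insert a (F - {a}) = F"
      using \<open>a \<in> F\<close> by blast
    moreover have "card F = Suc (card (F - {a}))"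
      using \<open>a \<in> F\<close> \<open>finite (F - {a})\<close> card_Suc_Diff1[of F a] by simp
    ultimately have "F \<in> X" "int (card F) - 1 = i + 1"
      unfolding face_dim_def using cone[of "F - {a}"] by (metis, linarith)
    then show "F \<in> X \<and> face_dim F = i + 1"
      by (simp add: face_dim_def)
  qed
  moreover have "boundary_map X c G = z G" for G
  proof (cases "a \<in> G")
    case False
    have "boundary_map X c G = (\<Sum>v\<in>?V - G. if v = a then z G else 0)"
      unfolding boundary_map_def using False by (intro sum.cong) (auto simp: c_def)
    also have "\<dots> = z G"
    proof (cases "z G = 0")
      case False
      then have "insert a G \<in> X"
        using z cone by (auto simp: chains_def)
      then show ?thesis
        using V \<open>a \<notin> G\<close> by (subst sum.delta) auto
    qed (auto intro!: sum.neutral)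
    finally show ?thesis .
  next
    case True
    define G' where "G' = G - {a}"
    have G: "G = insert a G'" "a \<notin> G'"
      using True by (auto simp: G'_def)
    \<comment> \<open>Swapping signs turns the sum into a multiple of the boundary of
      \<open>z\<close> at \<open>G'\<close> without its summand for \<open>v = a\<close>. As that
      boundary is zero, the sum equals minus the missing summand, a multiple of
      \<open>z G\<close>.\<close>
    have "boundary_map X c G
      = (\<Sum>v\<in>?V - G. - (incidence_sign a G' * (incidence_sign v G' * z (insert v G'))))"
      unfolding boundary_map_def
    proof (intro sum.cong refl)
      fix v assume "v \<in> ?V - G"
      then have v: "v \<noteq> a" "v \<notin> G'"
        using G by auto
      have c: "c (insert v G) = incidence_sign a (insert v G') * z (insert v G')"
        using v G(2) by (simp add: c_def G(1) insert_commute)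
      show "incidence_sign v G * c (insert v G)
        = - (incidence_sign a G' * (incidence_sign v G' * z (insert v G')))"
      proof (cases "z (insert v G') = 0")
        case False
        then have "finite G'"
          using fin by force
        then have sw: "incidence_sign a G' * incidence_sign v (insert a G')
          = - (incidence_sign v G' * incidence_sign a (insert v G') :: 'k)"
          using incidence_sign_swap[of a v G'] v G(2) by auto
        have "incidence_sign v G = incidence_sign a G' * (incidence_sign a G' * incidence_sign v (insert a G') :: 'k)"
          by (simp add: G(1))
        then have "incidence_sign v G * c (insert v G)
          = - (incidence_sign a G' * incidence_sign v G') * (incidence_sign a (insert v G') * c (insert v G))"
          by (simp add: sw mult_ac)
        then show ?thesis
          by (simp add: c mult.assoc)
      qed (simp add: c)
    qed
    also have "\<dots> = - incidence_sign a G' * (\<Sum>v\<in>?V - G. incidence_sign v G' * z (insert v G'))"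
      by (simp add: sum_negf sum_distrib_left)
    also have "(\<Sum>v\<in>?V - G. incidence_sign v G' * z (insert v G')) = - incidence_sign a G' * z G"
    proof -
      have "(\<Sum>v\<in>?V - G'. incidence_sign v G' * z (insert v G')) = 0"
        using fun_cong[OF cyc, of G'] by (simp add: boundary_map_def)
      moreover have "(\<Sum>v\<in>?V - G'. incidence_sign v G' * z (insert v G'))
        = (\<Sum>v\<in>?V - G. incidence_sign v G' * z (insert v G')) + incidence_sign a G' * z G"
      proof (cases "a \<in> ?V")
        case True
        then have split: "?V - G' = insert a (?V - G)"
          using G by auto
        have "(\<Sum>v\<in>insert a (?V - G). incidence_sign v G' * z (insert v G'))
          = incidence_sign a G' * z (insert a G') + (\<Sum>v\<in>?V - G. incidence_sign v G' * z (insert v G'))"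
          using V \<open>a \<in> G\<close> by (intro sum.insert) auto
        then show ?thesis
          unfolding split by (simp only: G(1)[symmetric] add.commute)
      next
        case False
        then have "z G = 0"
          using z \<open>a \<in> G\<close> by (auto simp: chains_def)
        moreover have "?V - G' = ?V - G"
          using False G by auto
        ultimately show ?thesis
          by simp
      qed
      ultimately show ?thesis
        by (simp add: eq_neg_iff_add_eq_0)
    qed
    finally show ?thesis
      by simp
  qed
  ultimately show "\<exists>c\<in>chains (i + 1) X. z = boundary_map X c"
    by (intro bexI[of _ c]) auto
qed

section \<open>Mayer--Vietoris\<close>

text \<open>For a cycle \<open>z = x + y\<close>, the boundary of \<open>x\<close> is minus that of
  \<open>y\<close> and hence a cycle of the intersection. A filling \<open>u\<close> of it there
  corrects the pieces to cycles \<open>x - u\<close> of \<open>X\<close> and \<open>y + u\<close> of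
  \<open>Y\<close>, which bound separately.\<close>

lemma homology_zero_Un:
  assumes X: "simplicial_complex X" and Y: "simplicial_complex Y"
    and hX: "homology_zero TYPE('k::field) i X" and hY: "homology_zero TYPE('k) i Y"
    and hI: "homology_zero TYPE('k) (i - 1) (X \<inter> Y)"
  shows "homology_zero TYPE('k) i (X \<union> Y)"
proof -
  let ?U = "X \<union> Y"
  have U: "simplicial_complex ?U"
    using X Y by (rule simplicial_complex_Un)
  show ?thesis
  proof (rule homology_zeroI[OF U subset_refl])
    fix z :: "'a set \<Rightarrow> 'k"
    assume "z \<in> chains i ?U" and cyc: "boundary_map ?U z = 0"
    then obtain x y where x: "x \<in> chains i X" and y: "y \<in> chains i Y" and z: "z = x + y"
      using chains_Un by blast
    have "boundary_map ?U x = 0 - boundary_map ?U y"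
      using cyc by (simp add: z boundary_map_add eq_neg_iff_add_eq_0)
    then have "boundary_map ?U x \<in> chains (i - 1) Y"
      using boundary_map_chains_subcomplex[OF U Y _ y] by (metis chains_0 chains_diff sup_ge2)
    then have "boundary_map ?U x \<in> chains (i - 1) (X \<inter> Y)"
      using boundary_map_chains_subcomplex[OF U X _ x] by (intro chains_Int) auto
    then obtain u where u: "u \<in> chains (i - 1 + 1) (X \<inter> Y)" "boundary_map ?U x = boundary_map ?U u"
      using homology_zeroD[OF hI U _ _ boundary_map_boundary_map[OF U chains_mono[OF _ x]]] by blast
    then have u': "u \<in> chains i X" "u \<in> chains i Y"
      by (auto intro: chains_mono[rotated])
    have "boundary_map ?U (x - u) = 0"
      by (simp add: boundary_map_diff u(2))
    then obtain p where p: "p \<in> chains (i + 1) X" "x - u = boundary_map ?U p"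
      using homology_zeroD[OF hX U _ chains_diff[OF x u'(1)]] by blast
    have "boundary_map ?U (y + u) = 0"
      using cyc by (simp add: boundary_map_add z add.commute flip: u(2))
    then obtain q where q: "q \<in> chains (i + 1) Y" "y + u = boundary_map ?U q"
      using homology_zeroD[OF hY U _ chains_add[OF y u'(2)]] by blast
    have "z = x - u + (y + u)"
      by (simp add: z)
    also have "\<dots> = boundary_map ?U (p + q)"
      by (simp only: p(2) q(2) boundary_map_add)
    finally show "\<exists>c\<in>chains (i + 1) ?U. z = boundary_map ?U c"
      using p(1) q(1) by (intro bexI[of _ "p + q"]) (auto intro!: chains_add intro: chains_mono[rotated])
  qed
qed

text \<open>A cycle of \<open>Y\<close> bounds some \<open>x + y\<close> in the union. Replacing
  \<open>x\<close> by a chain \<open>u\<close> of \<open>X \<inter> Y\<close> with the same boundary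
  moves the filling into \<open>Y\<close>.\<close>

lemma homology_zero_Un_cancel:
  assumes X: "simplicial_complex X" and Y: "simplicial_complex Y"
    and hU: "homology_zero TYPE('k::field) i (X \<union> Y)"
    and hI: "homology_zero TYPE('k) i (X \<inter> Y)"
  shows "homology_zero TYPE('k) i Y"
proof -
  let ?U = "X \<union> Y"
  have U: "simplicial_complex ?U"
    using X Y by (rule simplicial_complex_Un)
  show ?thesis
  proof (rule homology_zeroI[OF U])
    fix z :: "'a set \<Rightarrow> 'k"
    assume z: "z \<in> chains i Y" and cyc: "boundary_map ?U z = 0"
    then obtain w where w: "w \<in> chains (i + 1) ?U" "z = boundary_map ?U w"
      using homology_zeroD[OF hU U subset_refl chains_mono[OF _ z] cyc] by blast
    obtain x y where x: "x \<in> chains (i + 1) X" and y: "y \<in> chains (i + 1) Y" and wxy: "w = x + y"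
      using w(1) chains_Un by blast
    have dx: "boundary_map ?U x = z - boundary_map ?U y"
      by (simp add: w(2) wxy boundary_map_add)
    have "boundary_map ?U x \<in> chains i Y"
      unfolding dx using boundary_map_chains_subcomplex[OF U Y _ y] z by (intro chains_diff) auto
    then have "boundary_map ?U x \<in> chains i (X \<inter> Y)"
      using boundary_map_chains_subcomplex[OF U X _ x] by (intro chains_Int) auto
    then obtain u where u: "u \<in> chains (i + 1) (X \<inter> Y)" "boundary_map ?U x = boundary_map ?U u"
      using homology_zeroD[OF hI U _ _ boundary_map_boundary_map[OF U chains_mono[OF _ x]]] by blast
    have "z = boundary_map ?U (u + y)"
      using dx by (simp add: u(2) boundary_map_add)
    then show "\<exists>c\<in>chains (i + 1) Y. z = boundary_map ?U c"
      using u(1) y by (intro bexI[of _ "u + y"]) (auto intro!: chains_add intro: chains_mono[rotated])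
  qed auto
qed

text \<open>In the next two lemmas a cycle of \<open>X \<inter> Y\<close> is the boundary both of a chain \<open>x\<close> of \<open>X\<close>
  and of a chain \<open>y\<close> of \<open>Y\<close>, and \<open>x - y\<close> is the corresponding cycle of \<open>X \<union> Y\<close>.\<close>

lemma homology_zero_Int:
  assumes X: "simplicial_complex X" and Y: "simplicial_complex Y"
    and hX: "homology_zero TYPE('k::field) i X" and hY: "homology_zero TYPE('k) i Y"
    and hU: "homology_zero TYPE('k) (i + 1) (X \<union> Y)"
  shows "homology_zero TYPE('k) i (X \<inter> Y)"
proof -
  let ?U = "X \<union> Y"
  have U: "simplicial_complex ?U"
    using X Y by (rule simplicial_complex_Un)
  show ?thesis
  proof (rule homology_zeroI[OF U])
    fix z :: "'a set \<Rightarrow> 'k"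
    assume z: "z \<in> chains i (X \<inter> Y)" and cyc: "boundary_map ?U z = 0"
    obtain x where x: "x \<in> chains (i + 1) X" "z = boundary_map ?U x"
      using homology_zeroD[OF hX U _ chains_mono[OF _ z] cyc] by blast
    obtain y where y: "y \<in> chains (i + 1) Y" "z = boundary_map ?U y"
      using homology_zeroD[OF hY U _ chains_mono[OF _ z] cyc] by blast
    have "x - y \<in> chains (i + 1) ?U" "boundary_map ?U (x - y) = 0"
      using chains_mono[OF _ x(1)] chains_mono[OF _ y(1)] x(2) y(2)
      by (auto intro!: chains_diff simp: boundary_map_diff)
    then obtain w where w: "w \<in> chains (i + 1 + 1) ?U" "x - y = boundary_map ?U w"
      using homology_zeroD[OF hU U subset_refl] by blast
    obtain p q where p: "p \<in> chains (i + 1 + 1) X" and q: "q \<in> chains (i + 1 + 1) Y" and wpq: "w = p + q"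
      using w(1) chains_Un by blast
    \<comment> \<open>The left side is a chain of \<open>X\<close> and the right side one of
      \<open>Y\<close>, so this common chain lies in the intersection.\<close>
    have eq: "x - boundary_map ?U p = y + boundary_map ?U q"
      using w(2) by (simp add: wpq boundary_map_add algebra_simps)
    have "x - boundary_map ?U p \<in> chains (i + 1) X"
      using boundary_map_chains_subcomplex'[OF U X _ p] x(1) by (intro chains_diff) auto
    moreover have "y + boundary_map ?U q \<in> chains (i + 1) Y"
      using boundary_map_chains_subcomplex'[OF U Y _ q] y(1) by (intro chains_add) auto
    ultimately have "x - boundary_map ?U p \<in> chains (i + 1) (X \<inter> Y)"
      unfolding eq by (rule chains_Int)
    moreover have "z = boundary_map ?U (x - boundary_map ?U p)"
      using boundary_map_boundary_map[OF U chains_mono[OF _ p]] x(2) by (simp add: boundary_map_diff)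
    ultimately show "\<exists>c\<in>chains (i + 1) (X \<inter> Y). z = boundary_map ?U c"
      by blast
  qed auto
qed

lemma homology_iso_field_Int:
  assumes X: "simplicial_complex X" and Y: "simplicial_complex Y"
    and hX: "\<And>j. homology_zero TYPE('k::field) j X" and hY: "\<And>j. homology_zero TYPE('k) j Y"
    and hU: "homology_iso_field TYPE('k) (i + 1) (X \<union> Y)"
  shows "homology_iso_field TYPE('k) i (X \<inter> Y)"
proof -
  let ?U = "X \<union> Y" and ?d = "boundary_map (X \<union> Y)"
  have U: "simplicial_complex ?U" and sub: "X \<inter> Y \<subseteq> ?U"
    using X Y by (auto intro: simplicial_complex_Un)
  obtain Z :: "'a set \<Rightarrow> 'k" where Z: "Z \<in> cycles (i + 1) ?U" "Z \<notin> boundaries (i + 1) ?U"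
    and gen: "\<And>z. z \<in> cycles (i + 1) ?U \<Longrightarrow> \<exists>a. z - (\<lambda>F. a * Z F) \<in> boundaries (i + 1) ?U"
    using hU unfolding homology_iso_field_iff by blast
  \<comment> \<open>The class of \<open>?d P\<close> is the image of the class of \<open>Z\<close>
    under the connecting homomorphism; it will be the generator.\<close>
  obtain P Q where P: "P \<in> chains (i + 1) X" and Q: "Q \<in> chains (i + 1) Y" and ZPQ: "Z = P + Q"
    using Z(1) chains_Un unfolding cycles_iff by blast
  have dP: "?d P = 0 - ?d Q"
    using Z(1) by (simp add: cycles_iff ZPQ boundary_map_add eq_neg_iff_add_eq_0)
  have "?d P \<in> chains i Y"
    unfolding dP using boundary_map_chains_subcomplex[OF U Y _ Q] by (intro chains_diff) auto
  then have "?d P \<in> chains i (X \<inter> Y)"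
    using boundary_map_chains_subcomplex[OF U X _ P] by (intro chains_Int) auto
  then have cyc: "?d P \<in> cycles i (X \<inter> Y)"
    using boundary_map_boundary_map[OF U chains_mono[OF _ P]] by (simp add: cycles_subcomplex[OF U sub])
  \<comment> \<open>A filling \<open>u\<close> of \<open>?d P\<close> in the intersection would
    split \<open>Z\<close> into cycles of \<open>X\<close> and of \<open>Y\<close>. Both bound, so
    \<open>Z\<close> would bound as well.\<close>
  have "?d P \<notin> boundaries i (X \<inter> Y)"
  proof
    assume "?d P \<in> boundaries i (X \<inter> Y)"
    then obtain u where u: "u \<in> chains (i + 1) (X \<inter> Y)" "?d P = ?d u"
      by (auto simp: boundaries_subcomplex[OF U sub])
    have "P - u \<in> chains (i + 1) X" "?d (P - u) = 0"
      using P chains_mono[OF _ u(1)] u(2) by (auto intro!: chains_diff simp: boundary_map_diff)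
    then obtain p where p: "p \<in> chains (i + 1 + 1) X" "P - u = ?d p"
      using homology_zeroD[OF hX U] by blast
    have "Q + u \<in> chains (i + 1) Y"
      using Q chains_mono[OF _ u(1)] by (auto intro!: chains_add)
    moreover have "?d (Q + u) = 0"
      by (simp add: boundary_map_add dP flip: u(2))
    ultimately obtain q where q: "q \<in> chains (i + 1 + 1) Y" "Q + u = ?d q"
      using homology_zeroD[OF hY U] by blast
    have "Z = P - u + (Q + u)"
      by (simp add: ZPQ)
    also have "\<dots> = ?d (p + q)"
      by (simp only: p(2) q(2) boundary_map_add)
    finally have "Z \<in> boundaries (i + 1) ?U"
      using chains_add[OF chains_mono[OF _ p(1)] chains_mono[OF _ q(1)], of ?U]
      by (auto simp: boundaries_def)
    then show False
      using Z(2) by simp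
  qed
  moreover have "\<exists>a. z - (\<lambda>F. a * ?d P F) \<in> boundaries i (X \<inter> Y)" if z: "z \<in> cycles i (X \<inter> Y)" for z
  proof -
    have ch: "z \<in> chains i (X \<inter> Y)" and dz: "?d z = 0"
      using z by (auto simp: cycles_subcomplex[OF U sub])
    obtain x where x: "x \<in> chains (i + 1) X" "z = ?d x"
      using homology_zeroD[OF hX U _ chains_mono[OF _ ch] dz] by blast
    obtain y where y: "y \<in> chains (i + 1) Y" "z = ?d y"
      using homology_zeroD[OF hY U _ chains_mono[OF _ ch] dz] by blast
    have "x - y \<in> chains (i + 1) ?U" "?d (x - y) = 0"
      using chains_mono[OF _ x(1)] chains_mono[OF _ y(1)] x(2) y(2)
      by (auto intro!: chains_diff simp: boundary_map_diff)
    then obtain a w where w: "w \<in> chains (i + 1 + 1) ?U" "x - y - (\<lambda>F. a * Z F) = ?d w"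
      using gen by (metis boundariesE cycles_iff)
    obtain p q where p: "p \<in> chains (i + 1 + 1) X" and q: "q \<in> chains (i + 1 + 1) Y" and wpq: "w = p + q"
      using w(1) chains_Un by blast
    let ?aP = "\<lambda>F. a * P F" and ?aQ = "\<lambda>F. a * Q F"
    have "(\<lambda>F. a * Z F) = ?aP + ?aQ"
      by (simp add: ZPQ fun_eq_iff distrib_left)
    then have eq: "x - ?aP - ?d p = y + ?aQ + ?d q"
      using w(2) by (simp add: wpq boundary_map_add algebra_simps)
    have "x - ?aP - ?d p \<in> chains (i + 1) X"
      using boundary_map_chains_subcomplex'[OF U X _ p] x(1) chains_scale[OF P] by (intro chains_diff) auto
    moreover have "y + ?aQ + ?d q \<in> chains (i + 1) Y"
      using boundary_map_chains_subcomplex'[OF U Y _ q] y(1) chains_scale[OF Q] by (intro chains_add) auto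
    ultimately have "x - ?aP - ?d p \<in> chains (i + 1) (X \<inter> Y)"
      unfolding eq by (rule chains_Int)
    moreover have "z - (\<lambda>F. a * ?d P F) = ?d (x - ?aP - ?d p)"
      using boundary_map_boundary_map[OF U chains_mono[OF _ p]] x(2)
      by (simp add: boundary_map_diff boundary_map_scale)
    ultimately show ?thesis
      by (auto simp: boundaries_subcomplex[OF U sub])
  qed
  ultimately show ?thesis
    using cyc unfolding homology_iso_field_iff by blast
qed

section \<open>Top-dimensional cycles of homology spheres\<close>

lemma homology_sphereD:
  assumes "homology_sphere K m X"
  shows "simplicial_complex X" "complex_dim X = m"
    "\<And>F i. F \<in> X \<Longrightarrow> i \<noteq> complex_dim (link X F) \<Longrightarrow> homology_zero K i (link X F)"
    "\<And>F. F \<in> X \<Longrightarrow> homology_iso_field K (complex_dim (link X F)) (link X F)"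
  using assms unfolding homology_sphere_def by (blast, blast, metis, metis)

text \<open>Links in a link are links in \<open>X\<close>. The dimension stays unevaluated until
  \<open>complex_dim_link\<close>, which rests on the study of top-dimensional cycles.\<close>

lemma homology_sphere_link:
  assumes X: "homology_sphere K m X" and F: "F \<in> X"
  shows "homology_sphere K (complex_dim (link X F)) (link X F)"
proof -
  note c = homology_sphereD(1)[OF X]
  have "link (link X F) G = link X (F \<union> G) \<and> F \<union> G \<in> X" if "G \<in> link X F" for G
    using that link_link[OF c, of F G] by (simp add: in_link_iff[OF c])
  then show ?thesis
    using X simplicial_complex_link[OF c] unfolding homology_sphere_def by simp
qed

lemma homology_sphere_zero:
  assumes "homology_sphere TYPE('k::field) m X" "i \<noteq> m"
  shows "homology_zero TYPE('k) i X"
proof (cases "X = {}")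
  case False
  then have "{} \<in> X"
    using homology_sphereD(1)[OF assms(1)] simplicial_complexD by blast
  then show ?thesis
    using homology_sphereD(2)[OF assms(1)] homology_sphereD(3)[OF assms(1), of "{}" i] assms(2) by simp
qed (simp add: homology_zero_void)

lemma boundaries_top:
  assumes "simplicial_complex X" "complex_dim X \<le> m"
  shows "boundaries m X = {0 :: 'a set \<Rightarrow> 'k::field}"
proof -
  have "b = 0" if "b \<in> boundaries m X" for b :: "'a set \<Rightarrow> 'k"
    using that chains_above_dim[OF assms(1), of "m + 1"] assms(2) by (fastforce elim!: boundariesE)
  then show ?thesis
    by auto
qed

text \<open>There are no chains above the dimension, hence no nonzero top-dimensional boundaries,
  and a generator of the homology generates the space of cycles itself.\<close>

lemma homology_sphere_generator:
  assumes X: "homology_sphere TYPE('k::field) m X" and "X \<noteq> {}"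
  obtains Z :: "'a set \<Rightarrow> 'k::field" where "Z \<in> cycles m X" "Z \<noteq> 0"
    "\<And>z. z \<in> cycles m X \<Longrightarrow> \<exists>a. z = (\<lambda>F. a * Z F)"
proof -
  note c = homology_sphereD(1,2)[OF X]
  have "{} \<in> X"
    using assms(2) c(1) simplicial_complexD by blast
  then have "homology_iso_field TYPE('k) m X"
    using homology_sphereD(4)[OF X, of "{}"] c(2) by simp
  then obtain Z :: "'a set \<Rightarrow> 'k" where "Z \<in> cycles m X" "Z \<notin> boundaries m X"
    and *: "\<And>z. z \<in> cycles m X \<Longrightarrow> \<exists>a. z - (\<lambda>F. a * Z F) \<in> boundaries m X"
    unfolding homology_iso_field_iff by blast
  moreover have "\<exists>a. z = (\<lambda>F. a * Z F)" if z: "z \<in> cycles m X" for z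
  proof -
    obtain a where "z - (\<lambda>F. a * Z F) \<in> boundaries m X"
      using *[OF z] by blast
    then have "z - (\<lambda>F. a * Z F) = 0"
      using boundaries_top[OF c(1), of m, where 'k = 'k] c(2) by blast
    then show ?thesis
      by (metis eq_iff_diff_eq_0)
  qed
  ultimately show ?thesis
    using that by (metis boundaries_0)
qed

section \<open>Connectivity detected by homology in degree 0\<close>

lemma boundary_map_vertex:
  assumes X: "simplicial_complex X" and a: "{a} \<in> X"
  shows "boundary_map X (\<lambda>F. if F = {a} then 1 else (0 :: 'k::field)) = (\<lambda>G. if G = {} then 1 else 0)"
proof
  fix G :: "'a set"
  have V: "finite (\<Union>X)" "a \<in> \<Union>X"
    using finite_vertices[OF X] a by auto
  have "boundary_map X (\<lambda>F. if F = {a} then 1 else 0) G = (\<Sum>v\<in>\<Union>X - G. if v = a then (if G = {} then 1 else 0) else (0 :: 'k))"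
    unfolding boundary_map_def by (intro sum.cong) (auto simp: incidence_sign_def)
  also have "\<dots> = (if G = {} then 1 else 0)"
    using V by (subst sum.delta) auto
  finally show "boundary_map X (\<lambda>F. if F = {a} then 1 else 0) G = (if G = {} then 1 else (0 :: 'k))" .
qed

lemma vertex_chain: "{a} \<in> X \<Longrightarrow> (\<lambda>F. if F = {a} then 1 else 0) \<in> chains 0 X"
  by (auto simp: chains_def face_dim_def)

lemma vertex_difference_cycle:
  assumes "simplicial_complex X" "{s} \<in> X" "{t} \<in> X"
  shows "(\<lambda>F. if F = {s} then 1 else 0) - (\<lambda>F. if F = {t} then 1 else 0) \<in> cycles 0 X"
  using assms by (simp add: cycles_iff boundary_map_diff boundary_map_vertex vertex_chain chains_diff)

text \<open>If no edge left \<open>S\<close>, then restricting to \<open>S\<close> a 1-chain with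
  boundary \<open>{s}\<close> minus \<open>{t}\<close> would give a 1-chain with boundary
  \<open>{s}\<close> alone. But the 0-chain \<open>{s}\<close> is no cycle: its boundary is 1 at the
  empty face.\<close>

lemma edge_leaving_vertex_set:
  assumes X: "simplicial_complex X" and h: "homology_zero TYPE('k::field) 0 X"
    and s: "{s} \<in> X" "s \<in> S" and t: "{t} \<in> X" "t \<notin> S"
  obtains v w where "v \<in> S" "w \<notin> S" "{v, w} \<in> X"
proof (rule ccontr)
  assume no: "\<not> thesis"
  note edge = that
  have no_edge: "w \<in> S" if "v \<in> S" "{v, w} \<in> X" for v w
    using no edge[of v w] that by blast
  let ?e = "\<lambda>a F. if F = {a} then 1 else (0 :: 'k)"
  have "?e s - ?e t \<in> boundaries 0 X"
    using vertex_difference_cycle[OF X s(1) t(1)] h unfolding homology_zero_iff by blast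
  then obtain w where w: "w \<in> chains 1 X" "?e s - ?e t = boundary_map X w"
    by (auto elim: boundariesE)
  define w' where "w' = (\<lambda>F. if F \<subseteq> S then w F else 0)"
  have w': "w' \<in> chains 1 X"
    using w(1) by (auto simp: w'_def chains_def)
  have "boundary_map X w' G = ?e s G" for G
  proof (cases "G \<subseteq> S")
    case True
    have "w' (insert v G) = w (insert v G)" if "v \<notin> G" for v
    proof (cases "w (insert v G) = 0")
      case False
      then have "insert v G \<in> X" "face_dim (insert v G) = 1"
        using w(1) by (auto simp: chains_def)
      moreover from this have "finite (insert v G)"
        using finite_face[OF X, of "insert v G"] by simp
      ultimately have "card G = 1"
        using that by (simp add: face_dim_def)
      then obtain u where "G = {u}"
        by (auto simp: card_1_singleton_iff)
      then have "v \<in> S"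
        using no_edge[of u v] True \<open>insert v G \<in> X\<close> by (simp add: insert_commute)
      then show ?thesis
        using True by (simp add: w'_def)
    qed (simp add: w'_def)
    then have "boundary_map X w' G = boundary_map X w G"
      unfolding boundary_map_def by (intro sum.cong) auto
    also have "\<dots> = (?e s - ?e t) G"
      by (simp only: w(2))
    also have "\<dots> = ?e s G"
      using True t(2) by auto
    finally show ?thesis .
  next
    case False
    then have "boundary_map X w' G = 0"
      unfolding boundary_map_def by (intro sum.neutral) (auto simp: w'_def)
    then show ?thesis
      using False s(2) by auto
  qed
  then have "boundary_map X w' = ?e s"
    by blast
  then have "boundary_map X (?e s) = 0"
    using boundary_map_boundary_map[OF X w'] by simp
  then show False
    unfolding boundary_map_vertex[OF X s(1)] by (auto dest: fun_cong[of _ _ "{}"])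
qed

text \<open>This contraction collects the faces of \<open>z\<close> through \<open>a\<close> and
  removes \<open>a\<close> from them. By \<open>incidence_sign_swap\<close> it anticommutes with the
  boundary map, so it takes cycles to cycles.\<close>

lemma link_cycle:
  fixes z :: "'a set \<Rightarrow> 'k::field"
  assumes X: "simplicial_complex X" and z: "z \<in> cycles i X"
  shows "(\<lambda>G. if a \<in> G then 0 else incidence_sign a G * z (insert a G)) \<in> cycles (i - 1) (link X {a})"
    (is "?c \<in> _")
proof -
  have ch: "?c \<in> chains (i - 1) (link X {a})"
    unfolding chains_def
  proof (intro CollectI allI impI)
    fix G assume "?c G \<noteq> 0"
    then have a: "a \<notin> G" and "z (insert a G) \<noteq> 0"
      by (auto split: if_splits)
    then have G: "insert a G \<in> X" "face_dim (insert a G) = i"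
      using z by (auto simp: cycles_iff chains_def)
    then have "finite G"
      using finite_face[OF X, of "insert a G"] by simp
    then show "G \<in> link X {a} \<and> face_dim G = i - 1"
      using G a by (auto simp: in_link_iff[OF X] face_dim_def)
  qed
  moreover have "boundary_map X ?c G = 0" for G
  proof (cases "a \<in> G \<or> infinite G")
    case True
    have "?c (insert v G) = 0" for v
    proof (rule ccontr)
      assume nz: "?c (insert v G) \<noteq> 0"
      then have "insert v G \<in> link X {a}"
        using ch unfolding chains_def by blast
      then have "finite (insert v G)"
        by (rule finite_face[OF simplicial_complex_link[OF X]])
      then show False
        using True nz by auto
    qed
    then show ?thesis
      by (simp add: boundary_map_def)
  next
    case False
    have "boundary_map X ?c G = (\<Sum>v\<in>\<Union>X - insert a G. incidence_sign v G * ?c (insert v G))"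
      unfolding boundary_map_def using finite_vertices[OF X] by (intro sum.mono_neutral_right) auto
    also have "\<dots> = (\<Sum>v\<in>\<Union>X - insert a G. - incidence_sign a G * (incidence_sign v (insert a G) * z (insert v (insert a G))))"
    proof (intro sum.cong refl)
      fix v assume "v \<in> \<Union>X - insert a G"
      then have v: "v \<noteq> a" "v \<notin> G"
        by auto
      have "incidence_sign v G * ?c (insert v G)
        = incidence_sign v G * incidence_sign a (insert v G) * z (insert v (insert a G))"
        using v False by (simp add: insert_commute mult.assoc)
      also have "incidence_sign v G * incidence_sign a (insert v G) = - (incidence_sign a G * incidence_sign v (insert a G) :: 'k)"
        using v False by (intro incidence_sign_swap) auto
      finally show "incidence_sign v G * ?c (insert v G)
        = - incidence_sign a G * (incidence_sign v (insert a G) * z (insert v (insert a G)))"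
        by (simp add: mult.assoc)
    qed
    also have "\<dots> = - incidence_sign a G * boundary_map X z (insert a G)"
      by (simp only: boundary_map_def sum_distrib_left)
    also have "\<dots> = 0"
      using z by (simp add: cycles_iff)
    finally show ?thesis .
  qed
  then have "boundary_map X ?c = 0"
    by (simp add: fun_eq_iff)
  ultimately show ?thesis
    by (simp add: cycles_subcomplex[OF X link_subset[OF X]])
qed

text \<open>
  The vertices of the support of a top-dimensional cycle have no neighbours outside it: such a
  neighbour would be a vertex of a link avoided by the induced top-dimensional cycle of that link.
\<close>

lemma top_cycle_avoiding_vertex:
  fixes z :: "'a set \<Rightarrow> 'k::field"
  assumes "homology_sphere TYPE('k) m X" "z \<in> cycles m X" "{a} \<in> X" "\<And>F. a \<in> F \<Longrightarrow> z F = 0"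
  shows "z = 0"
proof -
  have "face_dim {a} \<le> m"
    using face_dim_le[OF homology_sphereD(1)[OF assms(1)] assms(3)] homology_sphereD(2)[OF assms(1)] by simp
  then have "m = int (nat m)"
    by (simp add: face_dim_def)
  then obtain n where "m = int n"
    by blast
  then show ?thesis
    using assms
  proof (induction n arbitrary: m X z a)
    case 0
    note X = homology_sphereD(1)[OF 0(2)]
    show ?case
    proof (rule ccontr)
      assume "z \<noteq> 0"
      then obtain F where F: "z F \<noteq> 0"
        by (auto simp: fun_eq_iff)
      then have "F \<in> X" "face_dim F = 0"
        using 0(1,3) by (auto simp: cycles_iff chains_def)
      then obtain b where b: "F = {b}"
        by (auto simp: face_dim_def card_1_singleton_iff)
      then have "a \<noteq> b"
        using F 0(5) by auto
      have "X \<noteq> {}"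
        using \<open>F \<in> X\<close> by blast
      from homology_sphere_generator[OF 0(2) this]
      obtain Z :: "'a set \<Rightarrow> 'k" where Z: "\<And>z. z \<in> cycles m X \<Longrightarrow> \<exists>a. z = (\<lambda>F. a * Z F)"
        by blast
      \<comment> \<open>In dimension 0 both \<open>z\<close> and the difference of the vertices
        \<open>a\<close> and \<open>b\<close> are multiples of \<open>Z\<close>. The difference
        shows that \<open>Z\<close> is nonzero at \<open>{a}\<close>, so the vanishing of
        \<open>z\<close> there makes \<open>\<alpha>\<close> zero.\<close>
      obtain \<alpha> where \<alpha>: "z = (\<lambda>F. \<alpha> * Z F)"
        using Z[OF 0(3)] by blast
      obtain \<beta> where \<beta>: "(\<lambda>F. if F = {a} then 1 else 0) - (\<lambda>F. if F = {b} then 1 else 0) = (\<lambda>F. \<beta> * Z F)"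
        using Z vertex_difference_cycle[OF X 0(4), of b] \<open>F \<in> X\<close> 0(1) unfolding b by auto
      have "\<beta> * Z {a} = 1"
        using fun_cong[OF \<beta>, of "{a}"] \<open>a \<noteq> b\<close> by simp
      moreover have "\<alpha> * Z {a} = 0"
        using 0(5)[of "{a}"] by (simp add: \<alpha>)
      ultimately show False
        using F by (auto simp: \<alpha>)
    qed
  next
    case (Suc n)
    note X = homology_sphereD(1)[OF Suc.prems(2)]
    show ?case
    proof (rule ccontr)
      assume "z \<noteq> 0"
      define S where "S = {v. \<exists>F. v \<in> F \<and> z F \<noteq> 0}"
      obtain F where F: "z F \<noteq> 0"
        using \<open>z \<noteq> 0\<close> by (auto simp: fun_eq_iff)
      then have FX: "F \<in> X" "face_dim F = m"
        using Suc.prems(3) by (auto simp: cycles_iff chains_def)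
      then have "F \<noteq> {}"
        using Suc.prems(1) by (auto simp: face_dim_def)
      then obtain s where "s \<in> F"
        by blast
      then have s: "{s} \<in> X" "s \<in> S"
        using F simplicial_complexD[OF X FX(1), of "{s}"] by (auto simp: S_def)
      have "a \<notin> S"
        using Suc.prems(5) by (auto simp: S_def)
      moreover have "homology_zero TYPE('k) 0 X"
        using homology_sphere_zero[OF Suc.prems(2)] Suc.prems(1) by simp
      ultimately obtain v w where v: "v \<in> S" and w: "w \<notin> S" and vw: "{v, w} \<in> X"
        using edge_leaving_vertex_set[OF X _ s Suc.prems(4)] by metis
      let ?L = "link X {v}"
      let ?y = "\<lambda>G. if v \<in> G then 0 else incidence_sign v G * z (insert v G)"
      have "{v} \<in> X"
        using simplicial_complexD[OF X vw] by blast
      note L = homology_sphere_link[OF Suc.prems(2) this]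
      obtain G where G: "v \<in> G" "z G \<noteq> 0"
        using v by (auto simp: S_def)
      then have "insert v (G - {v}) = G"
        by blast
      then have y: "?y (G - {v}) \<noteq> 0"
        using G by simp
      have ycyc: "?y \<in> cycles (m - 1) ?L"
        using link_cycle[OF X Suc.prems(3)] .
      have "complex_dim ?L = m - 1"
      proof -
        have "G - {v} \<in> ?L" "face_dim (G - {v}) = m - 1"
          using ycyc y unfolding cycles_iff chains_def by blast+
        moreover have "face_dim E \<le> m - 1" if "E \<in> ?L" for E
          using face_dim_link_vertex[OF X that] homology_sphereD(2)[OF Suc.prems(2)] by simp
        ultimately show ?thesis
          using complex_dim_eq_iff[OF simplicial_complex_link[OF X]] by (metis empty_iff)
      qed
      moreover have "{w} \<in> ?L"
        using vw v w by (auto simp: in_link_iff[OF X] insert_commute)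
      moreover have "?y E = 0" if "w \<in> E" for E
        using w that by (auto simp: S_def)
      ultimately have "?y = 0"
        using Suc.IH[of "m - 1" ?L ?y w] L ycyc Suc.prems(1) by (simp add: zero_fun_def)
      from fun_cong[OF this, of "G - {v}"] y show False
        unfolding zero_fun_def by blast
    qed
  qed
qed

text \<open>A generating cycle of top dimension cannot avoid \<open>a\<close>, so some face of
  dimension \<open>m\<close> contains \<open>a\<close>. Iterated, this yields the purity of homology
  spheres.\<close>

lemma complex_dim_link_vertex:
  assumes S: "homology_sphere TYPE('k::field) m X" and a: "{a} \<in> X"
  shows "complex_dim (link X {a}) = m - 1"
proof -
  note X = homology_sphereD(1)[OF S]
  obtain Z :: "'a set \<Rightarrow> 'k" where Z: "Z \<in> cycles m X" "Z \<noteq> 0"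
    using homology_sphere_generator[OF S] a by (metis empty_iff)
  then obtain F where F: "a \<in> F" "Z F \<noteq> 0"
    using top_cycle_avoiding_vertex[OF S Z(1) a] by blast
  then have FX: "F \<in> X" "face_dim F = m"
    using Z(1) by (auto simp: cycles_iff chains_def)
  have "F - {a} \<in> link X {a}"
    using F(1) FX(1) by (auto simp: in_link_iff[OF X] insert_absorb)
  moreover have "face_dim (F - {a}) = m - 1"
    using FX(2) F(1) card_Suc_Diff1[OF finite_face[OF X FX(1)] F(1)] unfolding face_dim_def by linarith
  moreover have "face_dim E \<le> m - 1" if "E \<in> link X {a}" for E
    using face_dim_link_vertex[OF X that] homology_sphereD(2)[OF S] by simp
  ultimately show ?thesis
    using complex_dim_eq_iff[OF simplicial_complex_link[OF X]] by (metis empty_iff)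
qed

lemma complex_dim_link:
  assumes "homology_sphere TYPE('k::field) m X" "F \<in> X"
  shows "complex_dim (link X F) = m - int (card F)"
proof -
  have "finite F"
    using finite_face[OF homology_sphereD(1)[OF assms(1)] assms(2)] .
  then show ?thesis
    using assms(2)
  proof (induction F rule: finite_induct)
    case empty
    then show ?case
      using homology_sphereD(2)[OF assms(1)] by simp
  next
    case (insert a F)
    note X = homology_sphereD(1)[OF assms(1)]
    have F: "F \<in> X"
      using simplicial_complexD[OF X insert.prems] by blast
    have "{a} \<in> link X F"
      using insert.prems insert.hyps by (auto simp: in_link_iff[OF X])
    then have "complex_dim (link (link X F) {a}) = m - int (card F) - 1"
      using complex_dim_link_vertex[OF homology_sphere_link[OF assms(1) F]] insert.IH[OF F] by simp
    moreover have "link (link X F) {a} = link X (insert a F)"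
      using link_link[OF X, of F "{a}"] insert.hyps by simp
    ultimately show ?case
      using insert.hyps by simp
  qed
qed

section \<open>Removing faces from homology spheres\<close>

text \<open>\<open>X\<close> is the union of the star of \<open>a\<close>, a cone, and the deletion
  \<open>D\<close>, which meet in the link of \<open>a\<close>. In degree \<open>m\<close>, a cycle
  of \<open>D\<close> avoids \<open>a\<close> and vanishes. In degree \<open>m - 1\<close>, the
  connecting map from the top homology of \<open>X\<close> to that of the link is a nonzero map of
  one-dimensional spaces, hence an isomorphism. The other degrees follow by exactness.\<close>

lemma homology_zero_delete_vertex:
  assumes S: "homology_sphere TYPE('k::field) m X" and a: "{a} \<in> X"
  shows "homology_zero TYPE('k) i {E \<in> X. a \<notin> E}"
proof -
  note X = homology_sphereD(1)[OF S]
  define St D where "St = {E \<in> X. insert a E \<in> X}" and "D = {E \<in> X. a \<notin> E}"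
  have cSt: "simplicial_complex St"
    unfolding St_def by (rule simplicial_complex_subset[OF X])
      (auto intro: simplicial_complexD[OF X] insert_mono)
  have cD: "simplicial_complex D"
    unfolding D_def by (rule simplicial_complex_subset[OF X]) (auto intro: simplicial_complexD[OF X])
  have U: "St \<union> D = X"
    by (auto simp: St_def D_def insert_absorb)
  have I: "St \<inter> D = link X {a}"
    by (auto simp: St_def D_def in_link_iff[OF X] intro: simplicial_complexD[OF X])
  have sub: "St \<subseteq> X" "D \<subseteq> X" "link X {a} \<subseteq> X"
    using U I by auto
  note L = homology_sphere_link[OF S a, unfolded complex_dim_link_vertex[OF S a]]
  have avoid: "z = 0" if "z \<in> cycles m X" "z \<in> chains m D" for z :: "'a set \<Rightarrow> 'k"
    by (rule top_cycle_avoiding_vertex[OF S that(1) a]) (use that(2) in \<open>auto simp: chains_def D_def\<close>)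
  consider "i = m" | "i = m - 1" | "i \<noteq> m" "i \<noteq> m - 1"
    by blast
  then have "homology_zero TYPE('k) i D"
  proof cases
    case 1
    show ?thesis
    proof (rule homology_zeroI[OF X sub(2)])
      fix z :: "'a set \<Rightarrow> 'k"
      assume z: "z \<in> chains i D" "boundary_map X z = 0"
      then have "z = 0"
        using chains_mono[OF sub(2) z(1)] 1 by (intro avoid) (auto simp: cycles_iff)
      then show "\<exists>c\<in>chains (i + 1) D. z = boundary_map X c"
        by (intro bexI[of _ 0]) auto
    qed
  next
    case 2
    have top_St: "x = 0" if x: "x \<in> chains m St" "boundary_map X x = 0" for x :: "'a set \<Rightarrow> 'k"
    proof -
      have "homology_zero TYPE('k) m St"
        by (rule homology_zero_cone[OF cSt, of a]) (auto simp: St_def)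
      then obtain c where c: "c \<in> chains (m + 1) St" "x = boundary_map X c"
        using homology_zeroD[OF _ X sub(1) x] by blast
      have "c = 0"
        using chains_above_dim[OF X _ chains_mono[OF sub(1) c(1)]] homology_sphereD(2)[OF S] by simp
      then show ?thesis
        using c(2) by simp
    qed
    have "{} \<in> link X {a}"
      using a by (simp add: in_link_iff[OF X])
    then have ne: "X \<noteq> {}" "link X {a} \<noteq> {}"
      using a by auto
    from homology_sphere_generator[OF S ne(1)]
    obtain Z :: "'a set \<Rightarrow> 'k" where Z: "Z \<in> cycles m X" "Z \<noteq> 0"
      by blast
    from homology_sphere_generator[OF L ne(2)]
    obtain W :: "'a set \<Rightarrow> 'k" where W: "\<And>z. z \<in> cycles (m - 1) (link X {a}) \<Longrightarrow> \<exists>\<alpha>. z = (\<lambda>F. \<alpha> * W F)"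
      by blast
    have "Z \<in> chains m (St \<union> D)"
      using Z(1) by (simp add: U cycles_iff)
    then obtain P Q where P: "P \<in> chains m St" and Q: "Q \<in> chains m D" and ZPQ: "Z = P + Q"
      by (rule chains_Un)
    have link_cycle: "boundary_map X x \<in> cycles (m - 1) (link X {a})"
      if x: "x \<in> chains m St" "boundary_map X x \<in> chains (m - 1) D" for x :: "'a set \<Rightarrow> 'k"
      using chains_Int[OF boundary_map_chains_subcomplex[OF X cSt sub(1) x(1)] x(2)]
        boundary_map_boundary_map[OF X chains_mono[OF sub(1) x(1)]]
      by (simp add: I cycles_subcomplex[OF X sub(3)])
    have dZ: "boundary_map X P = 0 - boundary_map X Q"
      using Z(1) by (simp add: cycles_iff ZPQ boundary_map_add eq_neg_iff_add_eq_0)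
    have "boundary_map X P \<in> chains (m - 1) D"
      unfolding dZ using boundary_map_chains_subcomplex[OF X cD sub(2) Q] by (intro chains_diff) auto
    then obtain \<beta> where \<beta>: "boundary_map X P = (\<lambda>F. \<beta> * W F)"
      using W link_cycle[OF P] by blast
    \<comment> \<open>Otherwise \<open>P\<close> is a top cycle of the star, hence zero, and the
      nonzero cycle \<open>Z\<close> avoids \<open>a\<close>.\<close>
    have "\<beta> \<noteq> 0"
    proof
      assume "\<beta> = 0"
      then have "boundary_map X P = 0"
        using \<beta> by (simp add: zero_fun_def)
      then have "Z = Q"
        using top_St[OF P] by (simp add: ZPQ)
      then show False
        using avoid[OF Z(1)] Q Z(2) by simp
    qed
    show ?thesis
    proof (rule homology_zeroI[OF X sub(2)])
      fix z :: "'a set \<Rightarrow> 'k"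
      assume z: "z \<in> chains i D" and dz: "boundary_map X z = 0"
      have "homology_zero TYPE('k) i X"
        using homology_sphere_zero[OF S] 2 by simp
      then obtain w where w: "w \<in> chains (i + 1) X" "z = boundary_map X w"
        using homology_zeroD[OF _ X subset_refl chains_mono[OF sub(2) z] dz] by blast
      have "w \<in> chains m (St \<union> D)"
        using w(1) 2 by (simp add: U)
      then obtain x y where x: "x \<in> chains m St" and y: "y \<in> chains m D" and wxy: "w = x + y"
        by (rule chains_Un)
      have dx: "boundary_map X x = z - boundary_map X y"
        by (simp add: w(2) wxy boundary_map_add)
      have "boundary_map X x \<in> chains (m - 1) D"
        unfolding dx using boundary_map_chains_subcomplex[OF X cD sub(2) y] z 2 by (intro chains_diff) auto
      then obtain \<alpha> where \<alpha>: "boundary_map X x = (\<lambda>F. \<alpha> * W F)"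
        using W link_cycle[OF x] by blast
      \<comment> \<open>Subtracting this multiple of the cycle \<open>Z\<close> from
        \<open>w\<close> keeps \<open>z\<close> as the boundary and cancels the part of the filling
        in the star.\<close>
      define P' Q' where "P' = (\<lambda>F. \<alpha> / \<beta> * P F)" and "Q' = (\<lambda>F. \<alpha> / \<beta> * Q F)"
      have dP': "boundary_map X P' = (\<lambda>F. \<alpha> / \<beta> * boundary_map X P F)"
        and dQ': "boundary_map X Q' = (\<lambda>F. \<alpha> / \<beta> * boundary_map X Q F)"
        unfolding P'_def Q'_def by (rule boundary_map_scale)+
      have "boundary_map X (x - P') = 0"
        using \<open>\<beta> \<noteq> 0\<close> by (simp add: boundary_map_diff dP' \<alpha> \<beta>)
      then have "x = P'"
        using top_St[OF chains_diff[OF x chains_scale[OF P]]] unfolding P'_def by (metis eq_iff_diff_eq_0)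
      moreover have "boundary_map X P' = 0 - boundary_map X Q'"
        unfolding dP' dQ' dZ by (simp add: fun_eq_iff)
      ultimately have "z = boundary_map X (y - Q')"
        using dx by (simp add: boundary_map_diff algebra_simps)
      moreover have "y - Q' \<in> chains (i + 1) D"
        using chains_diff[OF y chains_scale[OF Q]] 2 unfolding Q'_def by (metis diff_add_cancel)
      ultimately show "\<exists>c\<in>chains (i + 1) D. z = boundary_map X c"
        by blast
    qed
  next
    case 3
    then show ?thesis
      using homology_zero_Un_cancel[OF cSt cD] homology_sphere_zero[OF S] homology_sphere_zero[OF L]
      unfolding U I by blast
  qed
  then show ?thesis
    by (simp add: D_def)
qed

text \<open>Vertices are deleted one at a time. Among the faces avoiding \<open>A\<close>, those
  joinable to \<open>a\<close> and those avoiding \<open>a\<close> cover everything and meet in the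
  deletion of \<open>A\<close> inside the link of \<open>a\<close>, so Mayer--Vietoris
  applies.\<close>

lemma homology_zero_delete_face:
  assumes "homology_sphere TYPE('k::field) m X" "A \<in> X" "A \<noteq> {}"
  shows "homology_zero TYPE('k) i {E \<in> X. E \<inter> A = {}}"
proof -
  have "finite A"
    using finite_face[OF homology_sphereD(1)[OF assms(1)] assms(2)] .
  then show ?thesis
    using assms(3,1,2)
  proof (induction A arbitrary: m X rule: finite_ne_induct)
    case (singleton a)
    then show ?case
      using homology_zero_delete_vertex[of m X a i] by simp
  next
    case (insert a A)
    note X = homology_sphereD(1)[OF insert.prems(1)]
    have A: "A \<in> X" "{a} \<in> X" "A \<in> link X {a}"
      using insert.prems(2) insert.hyps(3) by (auto simp: in_link_iff[OF X] intro: simplicial_complexD[OF X])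
    define St D where "St = {E \<in> X. E \<inter> A = {} \<and> insert a E \<in> X}" and "D = {E \<in> X. E \<inter> insert a A = {}}"
    have cSt: "simplicial_complex St"
      unfolding St_def by (rule simplicial_complex_subset[OF X])
        (auto intro: simplicial_complexD[OF X] insert_mono)
    have cD: "simplicial_complex D"
      unfolding D_def by (rule simplicial_complex_subset[OF X]) (auto intro: simplicial_complexD[OF X])
    have "St \<union> D = {E \<in> X. E \<inter> A = {}}"
      by (auto simp: St_def D_def insert_absorb)
    moreover have "St \<inter> D = {E \<in> link X {a}. E \<inter> A = {}}"
      by (auto simp: St_def D_def in_link_iff[OF X] intro: simplicial_complexD[OF X])
    ultimately have "homology_zero TYPE('k) i D"
      using homology_zero_Un_cancel[OF cSt cD] insert.IH[OF insert.prems(1) A(1)]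
        insert.IH[OF homology_sphere_link[OF insert.prems(1) A(2)] A(3)] by simp
    then show ?case
      by (simp add: D_def)
  qed
qed

text \<open>The faces that omit a vertex of \<open>insert p P\<close> are covered by the deletion of
  \<open>p\<close> and a cone with apex \<open>p\<close>. The overlap is the complex of the same
  kind for \<open>P\<close> in the link of \<open>p\<close>; it is needed in degree
  \<open>i - 1\<close>, hence the generalisation over \<open>i\<close>.\<close>

lemma homology_zero_outside_star:
  assumes "homology_sphere TYPE('k::field) m X" "P \<in> X"
  shows "homology_zero TYPE('k) i {E \<in> X. \<not> P \<subseteq> E}"
proof -
  have "finite P"
    using finite_face[OF homology_sphereD(1)[OF assms(1)] assms(2)] .
  then show ?thesis
    using assms
  proof (induction P arbitrary: m X i rule: finite_induct)
    case empty
    then show ?case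
      by (simp add: homology_zero_void)
  next
    case (insert p P)
    note X = homology_sphereD(1)[OF insert.prems(1)]
    have P: "{p} \<in> X" "P \<in> link X {p}"
      using insert.prems(2) insert.hyps(2) by (auto simp: in_link_iff[OF X] intro: simplicial_complexD[OF X])
    define D Q where "D = {E \<in> X. p \<notin> E}" and "Q = {E \<in> X. insert p E \<in> X \<and> \<not> P \<subseteq> E}"
    have cD: "simplicial_complex D"
      unfolding D_def by (rule simplicial_complex_subset[OF X]) (auto intro: simplicial_complexD[OF X])
    have cQ: "simplicial_complex Q"
      unfolding Q_def by (rule simplicial_complex_subset[OF X])
        (auto intro: simplicial_complexD[OF X] insert_mono)
    have "D \<inter> Q = {E \<in> link X {p}. \<not> P \<subseteq> E}"
      by (auto simp: D_def Q_def in_link_iff[OF X] intro: simplicial_complexD[OF X])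
    then have "homology_zero TYPE('k) (i - 1) (D \<inter> Q)"
      using insert.IH[OF homology_sphere_link[OF insert.prems(1) P(1)] P(2)] by simp
    moreover have "homology_zero TYPE('k) i D"
      unfolding D_def by (rule homology_zero_delete_vertex[OF insert.prems(1) P(1)])
    moreover have "homology_zero TYPE('k) i Q"
      by (rule homology_zero_cone[OF cQ, of p]) (use insert.hyps(2) in \<open>auto simp: Q_def\<close>)
    ultimately have "homology_zero TYPE('k) i (D \<union> Q)"
      by (intro homology_zero_Un[OF cD cQ])
    moreover have "D \<union> Q = {E \<in> X. \<not> insert p P \<subseteq> E}"
      by (auto simp: D_def Q_def insert_absorb)
    ultimately show ?case
      by simp
  qed
qed

section \<open>Truncated stars in flag homology spheres\<close>

definition truncated_star :: "'a set set \<Rightarrow> 'a set \<Rightarrow> 'a set \<Rightarrow> 'a set set" where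
  "truncated_star M P A = {E \<in> M. E \<union> P \<in> M \<and> E \<inter> A = {}}"

text \<open>This is what remains of \<open>M\<close> after removing the interior faces of the
  truncated star, so the two complexes cover \<open>M\<close> and meet in the intended
  boundary.\<close>

definition star_complement :: "'a set set \<Rightarrow> 'a set \<Rightarrow> 'a set \<Rightarrow> 'a set set" where
  "star_complement M P A = {E \<in> M. \<not> P \<subseteq> E \<or> (\<exists>a\<in>A. insert a E \<in> M)}"

definition truncated_star_boundary :: "'a set set \<Rightarrow> 'a set \<Rightarrow> 'a set \<Rightarrow> 'a set set" where
  "truncated_star_boundary M P A = truncated_star M P A \<inter> star_complement M P A"

lemma simplicial_complex_truncated_star:
  assumes M: "simplicial_complex M"
  shows "simplicial_complex (truncated_star M P A)"
  unfolding truncated_star_def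
  by (rule simplicial_complex_subset[OF M]) (auto intro: simplicial_complexD[OF M] Un_mono)

lemma simplicial_complex_star_complement:
  assumes M: "simplicial_complex M"
  shows "simplicial_complex (star_complement M P A)"
  unfolding star_complement_def
  by (rule simplicial_complex_subset[OF M]) (auto 4 4 intro: simplicial_complexD[OF M] insert_mono)

text \<open>A face \<open>E\<close> outside the complement contains \<open>P\<close>, so
  \<open>E \<union> P\<close> is \<open>E\<close> itself; and it avoids \<open>A\<close>, since
  \<open>insert a E = E\<close> for \<open>a \<in> E\<close>.\<close>

lemma truncated_star_Un_complement: "truncated_star M P A \<union> star_complement M P A = M"
proof -
  have "E \<in> truncated_star M P A" if E: "E \<in> M" "E \<notin> star_complement M P A" for E
    using E by (fastforce simp: truncated_star_def star_complement_def Un_absorb2 insert_absorb)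
  then show ?thesis
    by (auto simp: truncated_star_def star_complement_def)
qed

text \<open>Truncated stars are closed under links. Vertices of \<open>P\<close> in \<open>E\<close>
  impose no further condition, and a vertex of \<open>A\<close> that does not extend
  \<open>E\<close> to a face cannot occur in the link of \<open>E\<close> in
  \<open>M\<close>.\<close>

lemma link_truncated_star:
  assumes M: "simplicial_complex M" and E: "E \<in> truncated_star M P A"
  shows "link (truncated_star M P A) E = truncated_star (link M E) (P - E) {a \<in> A. insert a E \<in> M}"
proof (intro set_eqI)
  fix G
  have un: "E \<union> (G \<union> (P - E)) = E \<union> G \<union> P" and int: "E \<inter> (G \<union> (P - E)) = {} \<longleftrightarrow> E \<inter> G = {}"
    by blast+
  have "E \<inter> A = {}"
    using E by (simp add: truncated_star_def)
  moreover have "insert a E \<in> M" if "a \<in> G" "E \<union> G \<in> M" for a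
    using that simplicial_complexD[OF M, of "E \<union> G" "insert a E"] by blast
  ultimately have avoid: "(E \<union> G) \<inter> A = {} \<longleftrightarrow> G \<inter> {a \<in> A. insert a E \<in> M} = {}" if "E \<union> G \<in> M"
    using that by (auto simp: disjoint_iff)
  \<comment> \<open>The equivalence \<open>avoid\<close> holds only when
    \<open>E \<union> G \<in> M\<close>; \<open>conj\<close> rewrites the last conjunct under that
    assumption.\<close>
  have conj: "(a \<and> b \<and> c \<and> e) = ((a \<and> b) \<and> (a \<and> c) \<and> f)" if "b \<Longrightarrow> e = f" for a b c e f
    using that by blast
  show "G \<in> link (truncated_star M P A) E
    \<longleftrightarrow> G \<in> truncated_star (link M E) (P - E) {a \<in> A. insert a E \<in> M}"
    unfolding in_link_iff[OF simplicial_complex_truncated_star[OF M]]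
    unfolding truncated_star_def mem_Collect_eq in_link_iff[OF M] un int using avoid by (rule conj)
qed

lemma link_truncated_star_boundary:
  assumes M: "simplicial_complex M" and E: "E \<in> truncated_star_boundary M P A"
  shows "link (truncated_star_boundary M P A) E
    = truncated_star_boundary (link M E) (P - E) {a \<in> A. insert a E \<in> M}"
proof -
  have E': "E \<in> truncated_star M P A"
    using E by (simp add: truncated_star_boundary_def)
  have c: "simplicial_complex (truncated_star_boundary M P A)"
    unfolding truncated_star_boundary_def
    by (intro simplicial_complex_Int simplicial_complex_truncated_star simplicial_complex_star_complement M)
  have "E \<union> G \<in> star_complement M P A
      \<longleftrightarrow> G \<in> star_complement (link M E) (P - E) {a \<in> A. insert a E \<in> M}"
    if G: "E \<inter> G = {}" "E \<union> G \<in> truncated_star M P A" for G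
  proof -
    have "E \<union> G \<in> M" "E \<inter> A = {}"
      using G(2) by (auto simp: truncated_star_def)
    moreover have "insert a E \<in> M" if "insert a (E \<union> G) \<in> M" for a
      using that simplicial_complexD[OF M, of _ "insert a E"] by blast
    moreover have "E \<union> insert a G = insert a (E \<union> G)" for a
      by blast
    ultimately show ?thesis
      using G(1) by (auto simp: star_complement_def in_link_iff[OF M])
  qed
  then show ?thesis
    using link_truncated_star[OF M E']
    by (auto simp: truncated_star_boundary_def in_link_iff[OF c[unfolded truncated_star_boundary_def]]
        in_link_iff[OF simplicial_complex_truncated_star[OF M]] set_eq_iff)
qed

lemma homology_zero_truncated_star:
  assumes S: "homology_sphere TYPE('k::field) m M" and PA: "P \<union> A \<in> M" "P \<inter> A = {}" "P \<union> A \<noteq> {}"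
  shows "homology_zero TYPE('k) i (truncated_star M P A)"
proof (cases "P = {}")
  case True
  then show ?thesis
    using homology_zero_delete_face[OF S, of A] PA by (simp add: truncated_star_def)
next
  case False
  then obtain p where p: "p \<in> P"
    by blast
  note M = homology_sphereD(1)[OF S]
  show ?thesis
  proof (rule homology_zero_cone[OF simplicial_complex_truncated_star[OF M], of _ _ p])
    fix E assume E: "E \<in> truncated_star M P A"
    then have "insert p E \<in> M"
      using p simplicial_complexD[OF M, of "E \<union> P" "insert p E"] by (auto simp: truncated_star_def)
    then show "insert p E \<in> truncated_star M P A"
      using E p PA(2) by (auto simp: truncated_star_def insert_absorb)
  qed
qed

text \<open>Induction on \<open>A\<close> adds the star of one vertex \<open>a\<close> at a time.
  Flagness makes the overlap with the previous complex a cone with apex \<open>a\<close>: if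
  \<open>a\<close> and \<open>b\<close> both extend \<open>E\<close>, so does the face
  \<open>{a, b}\<close>. Faces omitting part of \<open>P\<close> still do so after adding
  \<open>a\<close>, because \<open>a \<notin> P\<close>.\<close>

lemma homology_zero_star_complement:
  assumes S: "homology_sphere TYPE('k::field) m M" and flag: "flag_complex M"
    and PA: "P \<union> A \<in> M" "P \<inter> A = {}"
  shows "homology_zero TYPE('k) i (star_complement M P A)"
proof -
  note M = homology_sphereD(1)[OF S]
  have "finite A"
    using finite_face[OF M PA(1)] by simp
  then show ?thesis
    using PA
  proof (induction A arbitrary: i rule: finite_induct)
    case empty
    then show ?case
      using homology_zero_outside_star[OF S] by (simp add: star_complement_def)
  next
    case (insert a A)
    have PA: "P \<union> A \<in> M" "P \<inter> A = {}"
      using insert.prems by (auto intro: simplicial_complexD[OF M])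
    define St where "St = {E \<in> M. insert a E \<in> M}"
    have cSt: "simplicial_complex St"
      unfolding St_def by (rule simplicial_complex_subset[OF M])
        (auto intro: simplicial_complexD[OF M] insert_mono)
    note cC = simplicial_complex_star_complement[OF M, of P A]
    have "homology_zero TYPE('k) i St"
      by (rule homology_zero_cone[OF cSt, of a]) (auto simp: St_def)
    moreover have "homology_zero TYPE('k) (i - 1) (star_complement M P A \<inter> St)"
    proof (rule homology_zero_cone[OF simplicial_complex_Int[OF cC cSt], of a])
      fix E assume E: "E \<in> star_complement M P A \<inter> St"
      have "insert b (insert a E) \<in> M" if b: "b \<in> A" "insert b E \<in> M" for b
      proof -
        have "{a, b} \<in> M"
          using b(1) by (intro simplicial_complexD[OF M insert.prems(1)]) auto
        then have "E \<union> {a, b} \<in> M"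
          using E b(2) by (intro flag_complex_Un[OF M flag]) (auto simp: St_def)
        then show ?thesis
          by (simp add: insert_commute)
      qed
      then show "insert a E \<in> star_complement M P A \<inter> St"
        using E insert.prems(2) by (auto simp: star_complement_def St_def)
    qed
    ultimately have "homology_zero TYPE('k) i (star_complement M P A \<union> St)"
      using insert.IH[OF PA] by (intro homology_zero_Un[OF cC cSt])
    moreover have "star_complement M P A \<union> St = star_complement M P (insert a A)"
      by (auto simp: star_complement_def St_def)
    ultimately show ?case
      by simp
  qed
qed

section \<open>Truncated stars as balls and their boundary spheres\<close>

lemma simplicial_complex_truncated_star_boundary:
  "simplicial_complex M \<Longrightarrow> simplicial_complex (truncated_star_boundary M P A)"
  unfolding truncated_star_boundary_def
  by (intro simplicial_complex_Int simplicial_complex_truncated_star simplicial_complex_star_complement)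

text \<open>The truncated star and its complement are acyclic and their union is \<open>M\<close>,
  so the connecting homomorphism shifts the homology of \<open>M\<close> down by one degree.\<close>

lemma homology_truncated_star_boundary:
  assumes S: "homology_sphere TYPE('k::field) m M" and flag: "flag_complex M"
    and PA: "P \<union> A \<in> M" "P \<inter> A = {}" "P \<union> A \<noteq> {}"
  shows "homology_iso_field TYPE('k) (m - 1) (truncated_star_boundary M P A)"
    and "i \<noteq> m - 1 \<Longrightarrow> homology_zero TYPE('k) i (truncated_star_boundary M P A)"
proof -
  note M = homology_sphereD(1)[OF S]
  note cS = simplicial_complex_truncated_star[OF M, of P A]
    and cC = simplicial_complex_star_complement[OF M, of P A]
    and hS = homology_zero_truncated_star[OF S PA] and hC = homology_zero_star_complement[OF S flag PA(1,2)]
  have "{} \<in> M"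
    using simplicial_complexD[OF M PA(1)] by blast
  then have "homology_iso_field TYPE('k) (m - 1 + 1) M"
    using homology_sphereD(4)[OF S, of "{}"] homology_sphereD(2)[OF S] by simp
  then show "homology_iso_field TYPE('k) (m - 1) (truncated_star_boundary M P A)"
    unfolding truncated_star_boundary_def
    by (intro homology_iso_field_Int[OF cS cC hS hC]) (simp only: truncated_star_Un_complement)
  show "homology_zero TYPE('k) i (truncated_star_boundary M P A)" if "i \<noteq> m - 1"
    unfolding truncated_star_boundary_def
    using homology_sphere_zero[OF S, of "i + 1"] that
    by (intro homology_zero_Int[OF cS cC hS hC]) (simp add: truncated_star_Un_complement)
qed

text \<open>Nonzero homology in degree \<open>m - 1\<close> provides a face of that dimension. No
  face \<open>E\<close> is larger, since it is properly contained in a face of \<open>M\<close>: in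
  \<open>E \<union> P\<close> or in some \<open>insert a E\<close>.\<close>

lemma complex_dim_truncated_star_boundary:
  assumes S: "homology_sphere TYPE('k::field) m M" and flag: "flag_complex M"
    and PA: "P \<union> A \<in> M" "P \<inter> A = {}" "P \<union> A \<noteq> {}"
  shows "complex_dim (truncated_star_boundary M P A) = m - 1"
proof -
  note M = homology_sphereD(1)[OF S]
  let ?B = "truncated_star_boundary M P A"
  have cB: "simplicial_complex ?B"
    using M by (rule simplicial_complex_truncated_star_boundary)
  obtain Z :: "'a set \<Rightarrow> 'k" where Z: "Z \<in> cycles (m - 1) ?B" "Z \<notin> boundaries (m - 1) ?B"
    using homology_truncated_star_boundary(1)[OF S flag PA] unfolding homology_iso_field_iff by blast
  have "Z \<noteq> 0"
    using Z(2) boundaries_0 by metis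
  then obtain F where "Z F \<noteq> 0"
    by (auto simp: fun_eq_iff)
  then have F: "F \<in> ?B" "face_dim F = m - 1"
    using Z(1) unfolding cycles_iff chains_def by blast+
  have "face_dim E \<le> m - 1" if E: "E \<in> ?B" for E
  proof -
    have E': "E \<in> M" "E \<union> P \<in> M" "E \<inter> A = {}" "\<not> P \<subseteq> E \<or> (\<exists>a\<in>A. insert a E \<in> M)"
      using E by (auto simp: truncated_star_boundary_def truncated_star_def star_complement_def)
    have fin: "finite E"
      using finite_face[OF M E'(1)] .
    obtain E2 where E2: "E2 \<in> M" "E \<subset> E2"
      using E'(2-4) by (metis Un_upper1 disjoint_iff insertI1 psubsetI subset_Un_eq subset_insertI sup_commute)
    then have "card E < card E2"
      using finite_face[OF M] by (intro psubset_card_mono) auto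
    then show ?thesis
      using face_dim_le[OF M E2(1)] homology_sphereD(2)[OF S] by (simp add: face_dim_def)
  qed
  then show ?thesis
    using complex_dim_eq_iff[OF cB] F by (metis empty_iff)
qed

text \<open>Without a face of dimension \<open>m\<close>, a top-dimensional generator of
  \<open>M\<close> would be a cycle of the acyclic complement and hence a boundary, which is
  impossible in the top degree.\<close>

lemma complex_dim_truncated_star:
  assumes S: "homology_sphere TYPE('k::field) m M" and flag: "flag_complex M"
    and PA: "P \<union> A \<in> M" "P \<inter> A = {}"
  shows "complex_dim (truncated_star M P A) = m"
proof -
  note M = homology_sphereD(1)[OF S]
  have "M \<noteq> {}"
    using PA(1) by blast
  from homology_sphere_generator[OF S this]
  obtain Z :: "'a set \<Rightarrow> 'k" where Z: "Z \<in> cycles m M" "Z \<noteq> 0"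
    by blast
  have sub: "star_complement M P A \<subseteq> M" "truncated_star M P A \<subseteq> M"
    using truncated_star_Un_complement by blast+
  have "\<exists>F\<in>truncated_star M P A. face_dim F = m"
  proof (rule ccontr)
    assume no: "\<not> (\<exists>F\<in>truncated_star M P A. face_dim F = m)"
    have "Z \<in> chains m (star_complement M P A)"
      unfolding chains_def
    proof (intro CollectI allI impI)
      fix F assume "Z F \<noteq> 0"
      then have "F \<in> M" "face_dim F = m"
        using Z(1) unfolding cycles_iff chains_def by blast+
      then show "F \<in> star_complement M P A \<and> face_dim F = m"
        using no truncated_star_Un_complement by blast
    qed
    then obtain c where c: "c \<in> chains (m + 1) (star_complement M P A)" "Z = boundary_map M c"
      using homology_zeroD[OF homology_zero_star_complement[OF S flag PA] M sub(1)] Z(1)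
      unfolding cycles_iff by blast
    have "c = 0"
      using chains_above_dim[OF M _ chains_mono[OF sub(1) c(1)]] homology_sphereD(2)[OF S] by simp
    then show False
      using c(2) Z(2) by simp
  qed
  moreover have "face_dim F \<le> m" if "F \<in> truncated_star M P A" for F
    using face_dim_le[OF M, of F] that sub(2) homology_sphereD(2)[OF S] by blast
  ultimately show ?thesis
    using complex_dim_eq_iff[OF simplicial_complex_truncated_star[OF M]] by (metis empty_iff)
qed

text \<open>This lets the lemmas on truncated stars be applied inside the link of \<open>E\<close>.
  The vertices of \<open>P\<close> and the selected ones of \<open>A\<close> form a face and each
  extends \<open>E\<close>, so flagness joins them to \<open>E\<close>.\<close>

lemma truncated_star_link_face:
  assumes M: "simplicial_complex M" and flag: "flag_complex M"
    and PA: "P \<union> A \<in> M" and E: "E \<in> truncated_star M P A"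
  shows "(P - E) \<union> {a \<in> A. insert a E \<in> M} \<in> link M E"
proof -
  have EP: "E \<union> P \<in> M" "E \<in> M" "E \<inter> A = {}"
    using E by (auto simp: truncated_star_def)
  have "P \<union> {a \<in> A. insert a E \<in> M} \<in> M"
    by (rule simplicial_complexD[OF M PA]) blast
  then have "E \<union> (P \<union> {a \<in> A. insert a E \<in> M}) \<in> M"
    by (rule flag_complex_Un[OF M flag EP(2)]) (use simplicial_complexD[OF M EP(1)] in auto)
  moreover have "E \<union> ((P - E) \<union> {a \<in> A. insert a E \<in> M}) = E \<union> (P \<union> {a \<in> A. insert a E \<in> M})"
    by blast
  ultimately show ?thesis
    using EP(3) by (auto simp: in_link_iff[OF M])
qed

lemma homology_sphere_truncated_star_boundary:
  assumes S: "homology_sphere TYPE('k::field) m M" and flag: "flag_complex M"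
    and PA: "P \<union> A \<in> M" "P \<inter> A = {}" "P \<union> A \<noteq> {}"
  shows "homology_sphere TYPE('k) (m - 1) (truncated_star_boundary M P A)"
proof -
  note M = homology_sphereD(1)[OF S]
  let ?B = "truncated_star_boundary M P A"
  have "if i = complex_dim (link ?B E) then homology_iso_field TYPE('k) i (link ?B E)
        else homology_zero TYPE('k) i (link ?B E)" if E: "E \<in> ?B" for E i
  proof -
    have E': "E \<in> truncated_star M P A" "E \<in> M" "\<not> P \<subseteq> E \<or> (\<exists>a\<in>A. insert a E \<in> M)"
      using E by (auto simp: truncated_star_boundary_def truncated_star_def star_complement_def)
    note LS = homology_sphere_link[OF S E'(2)] and LF = flag_complex_link[OF M flag E'(2)]
      and LP = truncated_star_link_face[OF M flag PA(1) E'(1)]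
    \<comment> \<open>A boundary face omits part of \<open>P\<close> or is extended by a vertex of
      \<open>A\<close>, so the parameters of its link are not both empty and the preceding lemmas
      apply to the link.\<close>
    have disj: "(P - E) \<inter> {a \<in> A. insert a E \<in> M} = {}" "(P - E) \<union> {a \<in> A. insert a E \<in> M} \<noteq> {}"
      using PA(2) E'(3) by auto
    show ?thesis
      using complex_dim_truncated_star_boundary[OF LS LF LP disj]
        homology_truncated_star_boundary[OF LS LF LP disj]
      unfolding link_truncated_star_boundary[OF M E] by simp
  qed
  then show ?thesis
    unfolding homology_sphere_def
    using simplicial_complex_truncated_star_boundary[OF M] complex_dim_truncated_star_boundary[OF S flag PA]
    by blast
qed

text \<open>If \<open>P\<close> and \<open>A\<close> are empty, then the truncated star is the whole sphere \<open>M\<close>; the only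
  sphere that is also a ball (with void boundary) is \<open>{{}}\<close>.\<close>

lemma homology_ball_truncated_star:
  assumes S: "homology_sphere TYPE('k::field) m M" and flag: "flag_complex M"
    and PA: "P \<union> A \<in> M" "P \<inter> A = {}" and empty: "P \<union> A = {} \<Longrightarrow> M = {{}}"
  shows "homology_ball_with_boundary TYPE('k) m (truncated_star M P A) (truncated_star_boundary M P A)"
proof -
  note M = homology_sphereD(1)[OF S]
  let ?K = "truncated_star M P A" and ?B = "truncated_star_boundary M P A"
  have "homology_sphere TYPE('k) (m - 1) ?B"
  proof (cases "P \<union> A = {}")
    case True
    have "?B = {}"
      using True by (auto simp: truncated_star_boundary_def star_complement_def)
    moreover have "m = - 1"
      using homology_sphereD(2)[OF S] empty[OF True] by (simp add: complex_dim_def face_dim_def)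
    ultimately show ?thesis
      by (simp add: homology_sphere_def simplicial_complex_def complex_dim_def)
  next
    case False
    then show ?thesis
      by (rule homology_sphere_truncated_star_boundary[OF S flag PA])
  qed
  moreover have "if E \<notin> ?B \<and> i = complex_dim (link ?K E) then homology_iso_field TYPE('k) i (link ?K E)
        else homology_zero TYPE('k) i (link ?K E)" if E: "E \<in> ?K" for E i
  proof -
    have E': "E \<in> M"
      using E by (simp add: truncated_star_def)
    note LS = homology_sphere_link[OF S E']
      and LP = truncated_star_link_face[OF M flag PA(1) E]
    have disj: "(P - E) \<inter> {a \<in> A. insert a E \<in> M} = {}"
      using PA(2) by auto
    \<comment> \<open>Boundary faces are those whose link has a nonempty parameter and is therefore
      acyclic. For interior faces both parameters vanish, and the link is a link in the sphere
      \<open>M\<close>.\<close>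
    have B: "E \<in> ?B \<longleftrightarrow> (P - E) \<union> {a \<in> A. insert a E \<in> M} \<noteq> {}"
      using E E' by (auto simp: truncated_star_boundary_def star_complement_def)
    show ?thesis
    proof (cases "E \<in> ?B")
      case True
      then show ?thesis
        using homology_zero_truncated_star[OF LS LP disj] B by (simp add: link_truncated_star[OF M E])
    next
      case False
      then have "P - E = {}" and "{a \<in> A. insert a E \<in> M} = {}"
        using B by blast+
      then have "link ?K E = truncated_star (link M E) {} {}"
        unfolding link_truncated_star[OF M E] by (simp only:)
      then have "link ?K E = link M E"
        by (simp add: truncated_star_def)
      then show ?thesis
        using homology_sphereD(3,4)[OF S E'] False by simp
    qed
  qed
  ultimately show ?thesis
    unfolding homology_ball_with_boundary_def
    using simplicial_complex_truncated_star[OF M] complex_dim_truncated_star[OF S flag PA]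
    by (auto simp: truncated_star_boundary_def)
qed

section \<open>The subdivision of the cross-polytope\<close>

definition cross_map :: "nat \<Rightarrow> (nat \<Rightarrow> 'a) \<Rightarrow> 'a set set \<Rightarrow> 'a set \<Rightarrow> cross_vertex set" where
  "cross_map d x \<Delta> E =
     Upper ` {i \<in> {1..d}. x i \<in> E} \<union> Lower ` {i \<in> {1..d}. insert (x i) E \<notin> \<Delta>}"

lemma cross_map_subset_iff:
  "cross_map d x \<Delta> E \<subseteq> F \<longleftrightarrow>
     (\<forall>i\<in>{1..d}. (x i \<in> E \<longrightarrow> Upper i \<in> F) \<and> (insert (x i) E \<notin> \<Delta> \<longrightarrow> Lower i \<in> F))"
  by (auto simp: cross_map_def)

lemma in_cross_polytope_boundary_iff:
  "F \<in> cross_polytope_boundary d \<longleftrightarrow>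
     F \<subseteq> Upper ` {1..d} \<union> Lower ` {1..d} \<and> (\<forall>i\<in>{1..d}. \<not> (Upper i \<in> F \<and> Lower i \<in> F))"
proof -
  have "card (F \<inter> {Upper i, Lower i}) \<le> 1 \<longleftrightarrow> \<not> (Upper i \<in> F \<and> Lower i \<in> F)" for i
    by (cases "Upper i \<in> F"; cases "Lower i \<in> F") auto
  then show ?thesis
    by (simp add: cross_polytope_boundary_def)
qed

lemma simplicial_complex_cross_polytope_boundary:
  "simplicial_complex (cross_polytope_boundary d)"
proof -
  have "finite (Pow (Upper ` {1..d} \<union> Lower ` {1..d}))"
    by simp
  moreover have "cross_polytope_boundary d \<subseteq> Pow (Upper ` {1..d} \<union> Lower ` {1..d})"
    by (auto simp: cross_polytope_boundary_def)
  ultimately have "finite (cross_polytope_boundary d)"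
    by (rule finite_subset[rotated])
  moreover have "finite F" if "F \<in> cross_polytope_boundary d" for F
    using that by (auto simp: cross_polytope_boundary_def intro: finite_subset)
  moreover have "G \<in> cross_polytope_boundary d" if "F \<in> cross_polytope_boundary d" "G \<subseteq> F" for F G
  proof -
    have "G \<subseteq> Upper ` {1..d} \<union> Lower ` {1..d}"
      using that(1) by (intro subset_trans[OF that(2)]) (simp only: in_cross_polytope_boundary_iff)
    moreover have "\<forall>i\<in>{1..d}. \<not> (Upper i \<in> G \<and> Lower i \<in> G)"
      using that(1) subsetD[OF that(2)] unfolding in_cross_polytope_boundary_iff by meson
    ultimately show ?thesis
      by (simp only: in_cross_polytope_boundary_iff)
  qed
  ultimately show ?thesis
    by (simp add: simplicial_complex_def)
qed

text \<open>For a face \<open>E\<close> carried by \<open>F\<close>: if \<open>F\<close> misses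
  \<open>Upper i\<close>, then \<open>x i \<notin> E\<close>; if it misses \<open>Lower i\<close>,
  then \<open>x i\<close> extends \<open>E\<close>. So \<open>E\<close> avoids \<open>W\<close> and
  \<open>A\<close>, and every vertex of \<open>W\<close> and \<open>P\<close> extends
  \<open>E\<close>; flagness turns these single extensions into one face
  \<open>E \<union> W \<union> P\<close>.\<close>

lemma restriction_cross_map:
  assumes \<Delta>: "simplicial_complex \<Delta>" and flag: "flag_complex \<Delta>"
    and inj: "inj_on x {1..d}" and facet: "x ` {1..d} \<in> \<Delta>"
    and F: "F \<in> cross_polytope_boundary d"
  defines "P \<equiv> x ` {i \<in> {1..d}. Upper i \<in> F}" and "A \<equiv> x ` {i \<in> {1..d}. Lower i \<in> F}"
    and "M \<equiv> link \<Delta> (x ` {i \<in> {1..d}. Upper i \<notin> F \<and> Lower i \<notin> F})"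
  shows "restriction \<Delta> (cross_map d x \<Delta>) F = truncated_star M P A"
    and "{E \<in> \<Delta>. cross_map d x \<Delta> E = F} = truncated_star M P A - truncated_star_boundary M P A"
proof -
  let ?\<sigma> = "cross_map d x \<Delta>"
  define W where "W = x ` {i \<in> {1..d}. Upper i \<notin> F \<and> Lower i \<notin> F}"
  have FS: "F \<subseteq> Upper ` {1..d} \<union> Lower ` {1..d}" and FD: "\<And>i. i \<in> {1..d} \<Longrightarrow> \<not> (Upper i \<in> F \<and> Lower i \<in> F)"
    using F by (auto simp: in_cross_polytope_boundary_iff)
  have mem: "x i \<in> P \<longleftrightarrow> Upper i \<in> F" "x i \<in> A \<longleftrightarrow> Lower i \<in> F" "x i \<in> W \<longleftrightarrow> Upper i \<notin> F \<and> Lower i \<notin> F"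
    if "i \<in> {1..d}" for i
    using that inj_on_eq_iff[OF inj] by (auto simp: P_def A_def W_def)
  have range: "v \<in> x ` {1..d}" if "v \<in> P \<or> v \<in> A \<or> v \<in> W" for v
    using that by (auto simp: P_def A_def W_def)
  have disj: "W \<inter> P = {}" "W \<inter> A = {}"
    using mem range by blast+
  have M: "E \<in> M \<longleftrightarrow> W \<inter> E = {} \<and> W \<union> E \<in> \<Delta>" for E
    unfolding M_def W_def by (rule in_link_iff[OF \<Delta>])
  have face: "S \<in> \<Delta>" if "S \<subseteq> x ` {1..d}" for S
    using simplicial_complexD[OF \<Delta> facet that] .
  have restr: "E \<in> restriction \<Delta> ?\<sigma> F \<longleftrightarrow> E \<in> truncated_star M P A" for E
  proof
    assume "E \<in> restriction \<Delta> ?\<sigma> F"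
    then have E: "E \<in> \<Delta>" and u: "\<And>i. i \<in> {1..d} \<Longrightarrow> x i \<in> E \<Longrightarrow> Upper i \<in> F"
      and l: "\<And>i. i \<in> {1..d} \<Longrightarrow> Lower i \<notin> F \<Longrightarrow> insert (x i) E \<in> \<Delta>"
      by (auto simp: restriction_def cross_map_subset_iff)
    have "W \<inter> E = {}" "E \<inter> A = {}"
      using u mem range FD by blast+
    moreover have "E \<union> (W \<union> P) \<in> \<Delta>"
    proof (rule flag_complex_Un[OF \<Delta> flag E])
      show "W \<union> P \<in> \<Delta>"
        using range by (intro face) blast
      show "insert v E \<in> \<Delta>" if v: "v \<in> W \<union> P" for v
      proof -
        obtain i where i: "i \<in> {1..d}" "v = x i"
          using range[of v] v by blast
        then show ?thesis
          using v l[OF i(1)] mem[OF i(1)] FD[OF i(1)] by auto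
      qed
    qed
    moreover from this have "W \<union> E \<in> \<Delta>"
      by (rule simplicial_complexD[OF \<Delta>]) blast
    moreover have "W \<union> (E \<union> P) = E \<union> (W \<union> P)"
      by blast
    ultimately show "E \<in> truncated_star M P A"
      using disj by (auto simp: truncated_star_def M)
  next
    assume "E \<in> truncated_star M P A"
    then have E: "W \<inter> E = {}" "W \<union> (E \<union> P) \<in> \<Delta>" "E \<inter> A = {}"
      by (auto simp: truncated_star_def M)
    have "Upper i \<in> F" if "i \<in> {1..d}" "x i \<in> E" for i
      using E(1,3) mem[OF that(1)] that(2) by blast
    moreover have "Lower i \<in> F" if "i \<in> {1..d}" "insert (x i) E \<notin> \<Delta>" for i
    proof (rule ccontr)
      assume "Lower i \<notin> F"
      then have "insert (x i) E \<subseteq> W \<union> (E \<union> P)"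
        using mem[OF that(1)] by blast
      then show False
        using simplicial_complexD[OF \<Delta> E(2)] that(2) by blast
    qed
    moreover have "E \<in> \<Delta>"
      by (rule simplicial_complexD[OF \<Delta> E(2)]) blast
    ultimately show "E \<in> restriction \<Delta> ?\<sigma> F"
      by (simp add: restriction_def cross_map_subset_iff)
  qed
  then show "restriction \<Delta> ?\<sigma> F = truncated_star M P A"
    by blast
  have interior: "?\<sigma> E = F \<longleftrightarrow> E \<notin> star_complement M P A" if E: "E \<in> truncated_star M P A" for E
  proof -
    have E': "W \<inter> E = {}" "W \<union> E \<in> \<Delta>" "E \<in> M" "E \<in> \<Delta>"
      using E simplicial_complexD[OF \<Delta>, of "W \<union> E" E] by (auto simp: truncated_star_def M)
    \<comment> \<open>Passing to the link of \<open>W\<close> loses nothing: \<open>W\<close>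
      already joins \<open>E\<close>, and by flagness it joins \<open>insert (x i) E\<close> as soon
      as that is a face.\<close>
    have ins: "insert (x i) E \<in> M \<longleftrightarrow> insert (x i) E \<in> \<Delta>" if i: "i \<in> {1..d}" "Lower i \<in> F" for i
    proof
      assume "insert (x i) E \<in> M"
      then show "insert (x i) E \<in> \<Delta>"
        unfolding M by (meson simplicial_complexD[OF \<Delta>] sup_ge2)
    next
      assume *: "insert (x i) E \<in> \<Delta>"
      have "E \<union> insert (x i) W \<in> \<Delta>"
      proof (rule flag_complex_Un[OF \<Delta> flag E'(4)])
        show "insert (x i) W \<in> \<Delta>"
          using range i(1) by (intro face) blast
        show "insert v E \<in> \<Delta>" if "v \<in> insert (x i) W" for v
        proof (cases "v = x i")
          case False
          with that show ?thesis
            by (intro simplicial_complexD[OF \<Delta> E'(2)]) blast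
        qed (use * in simp)
      qed
      moreover have "W \<union> insert (x i) E = E \<union> insert (x i) W"
        by blast
      ultimately show "insert (x i) E \<in> M"
        using E'(1) mem[OF i(1)] i(2) by (simp add: M)
    qed
    have "?\<sigma> E \<subseteq> F"
      using iffD2[OF restr E] by (simp add: restriction_def)
    then have "?\<sigma> E = F \<longleftrightarrow> F \<subseteq> ?\<sigma> E"
      by (intro iffI subset_antisym) (erule equalityD2)
    also have "\<dots> \<longleftrightarrow> (\<forall>i\<in>{1..d}. (Upper i \<in> F \<longrightarrow> Upper i \<in> ?\<sigma> E) \<and> (Lower i \<in> F \<longrightarrow> Lower i \<in> ?\<sigma> E))"
      using FS by blast
    also have "\<dots> \<longleftrightarrow> (\<forall>i\<in>{1..d}. (Upper i \<in> F \<longrightarrow> x i \<in> E) \<and> (Lower i \<in> F \<longrightarrow> insert (x i) E \<notin> \<Delta>))"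
      by (intro ball_cong refl) (auto simp: cross_map_def)
    also have "\<dots> \<longleftrightarrow> P \<subseteq> E \<and> (\<forall>a\<in>A. insert a E \<notin> M)"
      using ins by (auto simp: P_def A_def)
    also have "\<dots> \<longleftrightarrow> E \<notin> star_complement M P A"
      using E'(3) by (auto simp: star_complement_def)
    finally show ?thesis .
  qed
  have "E \<in> truncated_star M P A" if "E \<in> \<Delta>" "?\<sigma> E = F" for E
    using restr[of E] that by (simp add: restriction_def)
  moreover have "E \<in> \<Delta>" if "E \<in> truncated_star M P A" for E
    using restr[of E] that by (simp add: restriction_def)
  ultimately show "{E \<in> \<Delta>. ?\<sigma> E = F} = truncated_star M P A - truncated_star_boundary M P A"
    using interior unfolding truncated_star_boundary_def by blast
qed

text \<open>A label \<open>Lower i\<close> of \<open>E\<close> is already a label of some vertex of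
  \<open>E\<close>: by flagness, if \<open>x i\<close> is joined to each vertex of \<open>E\<close>,
  then it extends \<open>E\<close>.\<close>

lemma vertex_induced_cross_map:
  assumes \<Delta>: "simplicial_complex \<Delta>" and flag: "flag_complex \<Delta>" and facet: "x ` {1..d} \<in> \<Delta>"
  shows "vertex_induced \<Delta> (cross_map d x \<Delta>) (cross_polytope_boundary d)"
  unfolding vertex_induced_def
proof (intro ballI impI)
  fix E F
  assume E: "E \<in> \<Delta>" and vert: "\<forall>v\<in>E. {v} \<in> restriction \<Delta> (cross_map d x \<Delta>) F"
  have "Upper i \<in> F" if "i \<in> {1..d}" "x i \<in> E" for i
    using bspec[OF vert that(2)] that(1) by (auto simp: restriction_def cross_map_subset_iff)
  moreover have "Lower i \<in> F" if i: "i \<in> {1..d}" "insert (x i) E \<notin> \<Delta>" for i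
  proof (rule ccontr)
    assume "Lower i \<notin> F"
    then have "insert v {x i} \<in> \<Delta>" if "v \<in> E" for v
      using bspec[OF vert that] i(1) by (auto simp: restriction_def cross_map_subset_iff insert_commute)
    moreover have "{x i} \<in> \<Delta>"
      using i(1) by (intro simplicial_complexD[OF \<Delta> facet]) auto
    ultimately have "{x i} \<union> E \<in> \<Delta>"
      by (intro flag_complex_Un[OF \<Delta> flag _ E])
    then show False
      using i(2) by simp
  qed
  ultimately show "E \<in> restriction \<Delta> (cross_map d x \<Delta>) F"
    using E by (simp add: restriction_def cross_map_subset_iff)
qed

text \<open>A vertex-induced restriction contains every face of \<open>\<Delta>\<close> spanned by
  its vertices, so its minimal non-faces are minimal non-faces of \<open>\<Delta>\<close>. The
  assumption \<open>mono\<close> ensures that the vertices of a carried face are carried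
  too.\<close>

lemma flag_subdivision_if_vertex_induced:
  assumes "simplicial_complex \<Delta>" "flag_complex \<Delta>" "vertex_induced \<Delta> \<sigma> \<Sigma>"
    and mono: "\<And>E v. E \<in> \<Delta> \<Longrightarrow> v \<in> E \<Longrightarrow> \<sigma> {v} \<subseteq> \<sigma> E"
  shows "flag_subdivision \<Delta> \<sigma> \<Sigma>"
  unfolding flag_subdivision_def flag_complex_def
proof (intro ballI allI impI)
  fix F N
  assume F: "F \<in> \<Sigma>" and N: "N \<subseteq> \<Union>(restriction \<Delta> \<sigma> F) \<and> N \<notin> restriction \<Delta> \<sigma> F
    \<and> (\<forall>M. M \<subset> N \<longrightarrow> M \<in> restriction \<Delta> \<sigma> F)"
  note verts = conjunct1[OF N] and nonface = conjunct1[OF conjunct2[OF N]]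
    and proper = conjunct2[OF conjunct2[OF N]]
  have vert: "{v} \<in> restriction \<Delta> \<sigma> F" if v: "v \<in> N" for v
  proof -
    have "v \<in> \<Union>(restriction \<Delta> \<sigma> F)"
      using verts v by (rule subsetD)
    then obtain E where E: "E \<in> \<Delta>" "\<sigma> E \<subseteq> F" "v \<in> E"
      by (auto simp: restriction_def)
    then have "{v} \<in> \<Delta>" "\<sigma> {v} \<subseteq> F"
      using mono[OF E(1,3)] simplicial_complexD[OF assms(1) E(1), of "{v}"] by auto
    then show ?thesis
      by (simp add: restriction_def)
  qed
  then have "N \<notin> \<Delta>"
    using assms(3) F nonface unfolding vertex_induced_def by blast
  moreover have "restriction \<Delta> \<sigma> F \<subseteq> \<Delta>"
    by (auto simp: restriction_def)
  then have "N \<subseteq> \<Union>\<Delta>" "\<forall>M. M \<subset> N \<longrightarrow> M \<in> \<Delta>"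
    using verts proper by (meson Union_mono subset_trans, meson subsetD)
  ultimately show "card N = 2"
    using assms(2) unfolding flag_complex_def by metis
qed

text \<open>A violating \<open>E\<close> would be a face of the restriction to \<open>F\<close>, a
  ball whose dimension is only \<open>face_dim F\<close>.\<close>

lemma quasi_geometric_if_vertex_induced:
  assumes sub: "homology_subdivision K \<Delta> \<sigma> \<Sigma>" and ind: "vertex_induced \<Delta> \<sigma> \<Sigma>"
  shows "quasi_geometric \<Delta> \<sigma> \<Sigma>"
  unfolding quasi_geometric_def
proof (intro notI, elim bexE conjE)
  fix E F
  assume E: "E \<in> \<Delta>" and F: "F \<in> \<Sigma>" and less: "face_dim F < face_dim E" and "\<forall>v\<in>E. \<sigma> {v} \<subseteq> F"
  moreover have "{v} \<in> \<Delta>" if "v \<in> E" for v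
    using sub E that unfolding homology_subdivision_def by (auto intro: simplicial_complexD)
  ultimately have "\<forall>v\<in>E. {v} \<in> restriction \<Delta> \<sigma> F"
    by (auto simp: restriction_def)
  then have "E \<in> restriction \<Delta> \<sigma> F"
    using ind E F unfolding vertex_induced_def by blast
  moreover have "simplicial_complex (restriction \<Delta> \<sigma> F)" "complex_dim (restriction \<Delta> \<sigma> F) = face_dim F"
    using sub F unfolding homology_subdivision_def homology_ball_with_boundary_def by blast+
  ultimately show False
    using face_dim_le less by fastforce
qed

text \<open>Used to show that the link of the \<open>x i\<close> with neither label in
  \<open>F\<close> has dimension \<open>face_dim F\<close>.\<close>

lemma card_cross_polytope_face:
  assumes "F \<in> cross_polytope_boundary d"
  shows "card F + card {i \<in> {1..d}. Upper i \<notin> F \<and> Lower i \<notin> F} = d"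
proof -
  let ?U = "{i \<in> {1..d}. Upper i \<in> F}" and ?L = "{i \<in> {1..d}. Lower i \<in> F}"
    and ?N = "{i \<in> {1..d}. Upper i \<notin> F \<and> Lower i \<notin> F}"
  have F: "F \<subseteq> Upper ` {1..d} \<union> Lower ` {1..d}" "?U \<inter> ?L = {}"
    using assms by (auto simp: in_cross_polytope_boundary_iff)
  then have "F = Upper ` ?U \<union> Lower ` ?L"
    by auto
  then have "card F = card (Upper ` ?U \<union> Lower ` ?L)"
    by (rule arg_cong)
  also have "\<dots> = card (Upper ` ?U) + card (Lower ` ?L)"
    by (intro card_Un_disjoint) auto
  also have "\<dots> = card ?U + card ?L"
    by (simp add: card_image inj_on_def)
  also have "\<dots> = card (?U \<union> ?L)"
    using F(2) by (intro card_Un_disjoint[symmetric]) auto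
  finally have "card F + card ?N = card (?U \<union> ?L) + card ?N"
    by simp
  also have "\<dots> = card ((?U \<union> ?L) \<union> ?N)"
    by (intro card_Un_disjoint[symmetric]) auto
  also have "(?U \<union> ?L) \<union> ?N = {1..d}"
    by auto
  finally show ?thesis
    by simp
qed

theorem theorem1p5:
  fixes \<Delta> :: "'a set set" and d :: nat
  assumes "homology_sphere TYPE('k::field) (int d - 1) \<Delta>"
    and "flag_complex \<Delta>"
  shows "\<exists>\<sigma> :: 'a set \<Rightarrow> cross_vertex set.
           homology_subdivision TYPE('k) \<Delta> \<sigma> (cross_polytope_boundary d) \<and>
           vertex_induced \<Delta> \<sigma> (cross_polytope_boundary d) \<and>
           quasi_geometric \<Delta> \<sigma> (cross_polytope_boundary d) \<and>
           flag_subdivision \<Delta> \<sigma> (cross_polytope_boundary d)"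
proof -
  note \<Delta> = homology_sphereD(1)[OF assms(1)] and dim = homology_sphereD(2)[OF assms(1)]
  \<comment> \<open>The void complex has dimension \<open>-2\<close>, while \<open>int d - 1\<close>
    is at least \<open>-1\<close>.\<close>
  have "\<Delta> \<noteq> {}"
    using dim by (auto simp: complex_dim_def)
  then obtain G where G: "G \<in> \<Delta>" "face_dim G = int d - 1"
    using complex_dim_eq_iff[OF \<Delta>] dim by blast
  then have cG: "card G = d" and fG: "finite G"
    using finite_face[OF \<Delta>] by (auto simp: face_dim_def)
  obtain x where x: "bij_betw x {1..d} G"
    using ex_bij_betw_nat_finite_1[OF fG] cG by blast
  then have inj: "inj_on x {1..d}" and img: "x ` {1..d} = G"
    by (auto simp: bij_betw_def)
  have facet: "x ` {1..d} \<in> \<Delta>"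
    using G(1) img by simp
  let ?\<sigma> = "cross_map d x \<Delta>" and ?\<Sigma> = "cross_polytope_boundary d"
  have sub: "homology_subdivision TYPE('k) \<Delta> ?\<sigma> ?\<Sigma>"
    unfolding homology_subdivision_def
  proof (intro conjI ballI)
    \<comment> \<open>\<open>Upper i\<close> and \<open>Lower i\<close> exclude each other: if
      \<open>x i \<in> E\<close>, then \<open>insert (x i) E = E\<close> is a face.\<close>
    show "?\<sigma> \<in> \<Delta> \<rightarrow> ?\<Sigma>"
      by (auto simp: in_cross_polytope_boundary_iff cross_map_def insert_absorb)
    fix F assume F: "F \<in> ?\<Sigma>"
    let ?W = "x ` {i \<in> {1..d}. Upper i \<notin> F \<and> Lower i \<notin> F}"
    let ?P = "x ` {i \<in> {1..d}. Upper i \<in> F}" and ?A = "x ` {i \<in> {1..d}. Lower i \<in> F}"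
    let ?M = "link \<Delta> ?W"
    have W: "?W \<in> \<Delta>"
      by (rule simplicial_complexD[OF \<Delta> facet]) blast
    have "card ?W = card {i \<in> {1..d}. Upper i \<notin> F \<and> Lower i \<notin> F}"
      by (intro card_image inj_on_subset[OF inj]) blast
    then have "int d - 1 - int (card ?W) = face_dim F"
      using card_cross_polytope_face[OF F] by (simp add: face_dim_def)
    then have S: "homology_sphere TYPE('k) (face_dim F) ?M"
      using homology_sphere_link[OF assms(1) W] complex_dim_link[OF assms(1) W] by simp
    have "?W \<union> (?P \<union> ?A) \<in> \<Delta>"
      by (rule simplicial_complexD[OF \<Delta> facet]) blast
    then have PA: "?P \<union> ?A \<in> ?M" "?P \<inter> ?A = {}"
      using F inj_on_eq_iff[OF inj] by (auto simp: in_link_iff[OF \<Delta>] in_cross_polytope_boundary_iff)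
    \<comment> \<open>This happens only for \<open>F = {}\<close>: then \<open>?W\<close> is the
      whole facet \<open>G\<close>, which has maximal dimension, so only the empty face lies in its
      link.\<close>
    have "?M = {{}}" if "?P \<union> ?A = {}"
    proof -
      have "?W = x ` {1..d}"
        using that by blast
      then have WG: "?W = G"
        using img by simp
      have "E = {}" if "E \<in> ?M" for E
      proof -
        have E: "G \<inter> E = {}" "G \<union> E \<in> \<Delta>"
          using that unfolding WG by (auto simp: in_link_iff[OF \<Delta>])
        then have "card (G \<union> E) \<le> card G"
          using face_dim_le[OF \<Delta> E(2)] dim cG by (simp add: face_dim_def)
        then have "G = G \<union> E"
          using finite_face[OF \<Delta> E(2)] by (intro card_seteq) auto
        then show ?thesis
          using E(1) by blast
      qed
      moreover have "{} \<in> ?M"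
        using W by (simp add: in_link_iff[OF \<Delta>])
      ultimately show ?thesis
        by blast
    qed
    then have "homology_ball_with_boundary TYPE('k) (face_dim F)
        (truncated_star ?M ?P ?A) (truncated_star_boundary ?M ?P ?A)"
      by (rule homology_ball_truncated_star[OF S flag_complex_link[OF \<Delta> assms(2) W] PA])
    then show "\<exists>B. homology_ball_with_boundary TYPE('k) (face_dim F) (restriction \<Delta> ?\<sigma> F) B \<and>
        {E \<in> \<Delta>. ?\<sigma> E = F} = restriction \<Delta> ?\<sigma> F - B"
      unfolding restriction_cross_map[OF \<Delta> assms(2) inj facet F] by blast
  qed (rule \<Delta> simplicial_complex_cross_polytope_boundary)+
  moreover note ind = vertex_induced_cross_map[OF \<Delta> assms(2) facet]
  moreover have "quasi_geometric \<Delta> ?\<sigma> ?\<Sigma>"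
    using sub ind by (rule quasi_geometric_if_vertex_induced)
  moreover have "flag_subdivision \<Delta> ?\<sigma> ?\<Sigma>"
  proof (rule flag_subdivision_if_vertex_induced[OF \<Delta> assms(2) ind])
    fix E v assume "E \<in> \<Delta>" "v \<in> E"
    then show "?\<sigma> {v} \<subseteq> ?\<sigma> E"
      unfolding cross_map_subset_iff
      by (auto simp: cross_map_def intro: simplicial_complexD[OF \<Delta>])
  qed
  ultimately show ?thesis
    by blast
qed

end
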